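(* Let $\Phi$ be a Young function with $\Phi(x)=-x^2\log x$ for $0\le x\le e^{-2/3}$. Let $\sigma\in M^1(\mathbb{Z}^n\times\mathbb{T}^n)$ and $g_1,g_2\in M^1(\mathbb{Z}^n)\cap\ell^\infty(\mathbb{Z}^n)$. Then there exists a bounded linear operator $\mathfrak{L}^{g_1,g_2}_\sigma:M^\Phi(\mathbb{Z}^n)\to M^\Phi(\mathbb{Z}^n)$ (the localization operator with symbol $\sigma$ and windows $g_1,g_2$) for which $$\|\mathfrak{L}^{g_1,g_2}_\sigma\|_{\mathcal{B}(M^\Phi(\mathbb{Z}^n))}\le\max\big(\|g_1\|_{M^1(\mathbb{Z}^n)}\|g_2\|_{\ell^\infty(\mathbb{Z}^n)},\ \|g_1\|_{\ell^\infty(\mathbb{Z}^n)}\|g_2\|_{M^1(\mathbb{Z}^n)}\big)\,\|\sigma\|_{M^1(\mathbb{Z}^n\times\mathbb{T}^n)}.$$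
   Context: A Young function is a convex function $\Phi:[0,\infty]\to[0,\infty]$ with $\Phi(0)=0$ and $\lim_{t\to\infty}\Phi(t)=\Phi(\infty)=\infty$. $\mathcal{S}(\mathbb{Z}^n)$ is the space of rapidly decreasing functions on $\mathbb{Z}^n$ ($|g(k)|\le C_{g,M}(1+|k|)^{-M}$ for every $M$) with seminorms $\sup_k(1+|k|)^j|g(k)|$, $j\in\mathbb{N}_0$; $\mathcal{S}'(\mathbb{Z}^n)$ is its topological dual. Translation and modulation are $T_kf(m)=f(m-k)$, $M_wf(m)=e^{2\pi i w\cdot m}f(m)$. The short-time Fourier transform is $V_gf(m,w)=\langle f,M_wT_mg\rangle=\sum_{k\in\mathbb{Z}^n}f(k)\overline{g(k-m)}e^{-2\pi i w\cdot k}$, $(m,w)\in\mathbb{Z}^n\times\mathbb{T}^n$. $L^\Phi(\mathbb{Z}^n\times\mathbb{T}^n)$ has norm $\|F\|_{L^\Phi}=\inf\{b>0:\sum_{m}\int_{\mathbb{T}^n}\Phi(|F(m,w)|/b)\,dw\le 1\}$. With a fixed non-zero window $g_0\in\mathcal{S}(\mathbb{Z}^n)$, $M^\Phi(\mathbb{Z}^n)$ (resp. $M^1(\mathbb{Z}^n)$) is the space of $f\in\mathcal{S}'(\mathbb{Z}^n)$ with $\|f\|_{M^\Phi(\mathbb{Z}^n)}=\|V_{g_0}f\|_{L^\Phi(\mathbb{Z}^n\times\mathbb{T}^n)}<\infty$ (resp. $\|f\|_{M^1(\mathbb{Z}^n)}=\|V_{g_0}f\|_{L^1(\mathbb{Z}^n\times\mathbb{T}^n)}<\infty$);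 the spaces are independent of the choice of window. $M^1(\mathbb{Z}^n\times\mathbb{T}^n)$ is the standard modulation space on the locally compact abelian group $\mathbb{Z}^n\times\mathbb{T}^n$ (dual group $\mathbb{T}^n\times\mathbb{Z}^n$): with a fixed non-zero Schwartz window $G$ on $\mathbb{Z}^n\times\mathbb{T}^n$, $\|\sigma\|_{M^1}$ is the $L^1$-norm over $(\mathbb{Z}^n\times\mathbb{T}^n)\times(\mathbb{T}^n\times\mathbb{Z}^n)$ of $V_G\sigma((m,w),(x,l))=\sum_{k\in\mathbb{Z}^n}\int_{\mathbb{T}^n}\sigma(k,y)\overline{G(k-m,y-w)}e^{-2\pi i(x\cdot k+l\cdot y)}\,dy$. The localization operator with symbol $\sigma$ and windows $g_1,g_2$ is given by $\mathfrak{L}^{g_1,g_2}_\sigma f(k)=\sum_{m\in\mathbb{Z}^n}\int_{\mathbb{T}^n}\sigma(m,w)V_{g_1}f(m,w)\,M_wT_mg_2(k)\,dw$, $k\in\mathbb{Z}^n$. $\mathcal{B}(M^\Phi(\mathbb{Z}^n))$ denotes the bounded linear operators on $M^\Phi(\mathbb{Z}^n)$ with the operator norm.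
   Formalization: Φ(x) = −x² log x is required only up to e^{-3/2} (no Young function satisfies it up to e^{-2/3}), and the bound with constant 1 is claimed after scaling the window G of M¹(Z^n×T^n) by a factor depending only on the windows, since it fails for small G. *)

theory Defs
  imports "HOL-Analysis.Analysis"
begin

text \<open>
  Functions on the torus \<open>T^n = R^n / Z^n\<close> are represented by \<open>Z^n\<close>-periodic functions on
  \<open>real^'n\<close>, and integrated over the unit cube; functions on \<open>Z^n \<times> T^n\<close> are curried.
\<close>

definition rvec :: "int^'n \<Rightarrow> real^'n" where
  "rvec k = (\<chi> i. real_of_int (k $ i))"

definition torus :: "(real^'n) measure" where
  "torus = restrict_space lborel (cbox 0 1)"

definition ztorus :: "((int^'n) \<times> (real^'n)) measure" where
  "ztorus = count_space UNIV \<Otimes>\<^sub>M torus"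

definition periodic :: "(real^'n \<Rightarrow> 'b) \<Rightarrow> bool" where
  "periodic u \<longleftrightarrow> (\<forall>w l. u (w + rvec l) = u w)"

definition schwartz_Z :: "(int^'n \<Rightarrow> complex) set" where
  "schwartz_Z = {g. \<forall>M::nat. \<exists>C. \<forall>k. norm (g k) \<le> C / (1 + norm (rvec k)) ^ M}"

definition seminorm_Z :: "nat \<Rightarrow> (int^'n \<Rightarrow> complex) \<Rightarrow> real" where
  "seminorm_Z j g = (SUP k. (1 + norm (rvec k)) ^ j * norm (g k))"

text \<open>
  A continuous linear functional \<open>F\<close> on \<open>schwartz_Z\<close> is determined by its values \<open>f k\<close> on the
  unit sequences, and \<open>F g\<close> is the sum of all \<open>f k * g k\<close>; as usual \<open>F\<close> is identified with
  \<open>f\<close>. The seminorms increase with \<open>j\<close>, so a single one suffices to express continuity.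
\<close>

definition dual_schwartz_Z :: "(int^'n \<Rightarrow> complex) set" where
  "dual_schwartz_Z = {f.
     (\<forall>g\<in>schwartz_Z. (\<lambda>k. f k * g k) summable_on UNIV) \<and>
     (\<exists>C j. \<forall>g\<in>schwartz_Z. norm (\<Sum>\<^sub>\<infinity>k. f k * g k) \<le> C * seminorm_Z j g)}"

fun partials :: "'n list \<Rightarrow> (real^'n \<Rightarrow> complex) \<Rightarrow> real^'n \<Rightarrow> complex" where
  "partials [] u = u"
| "partials (i # ix) u = (\<lambda>x. frechet_derivative (partials ix u) (at x) (axis i 1))"

definition smooth_fun :: "(real^'n \<Rightarrow> complex) \<Rightarrow> bool" where
  "smooth_fun u \<longleftrightarrow> (\<forall>ix x. partials ix u differentiable at x)"

definition schwartz_ZT :: "(int^'n \<Rightarrow> real^'n \<Rightarrow> complex) set" where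
  "schwartz_ZT = {G.
     (\<forall>k. periodic (G k) \<and> smooth_fun (G k)) \<and>
     (\<forall>ix. \<forall>M::nat. \<exists>C. \<forall>k w. norm (partials ix (G k) w) \<le> C / (1 + norm (rvec k)) ^ M)}"

definition seminorm_ZT :: "nat \<Rightarrow> (int^'n \<Rightarrow> real^'n \<Rightarrow> complex) \<Rightarrow> real" where
  "seminorm_ZT j G = (SUP (k, w, ix) \<in> UNIV \<times> UNIV \<times> {ix. length ix \<le> j}.
     (1 + norm (rvec k)) ^ j * norm (partials ix (G k) w))"

text \<open>
  The functions on \<open>Z^n \<times> T^n\<close> that define, by integration, a continuous linear functional
  on \<open>schwartz_ZT\<close>. Unlike on \<open>Z^n\<close> not every functional is of this form, but those whose
  short-time Fourier transform is integrable are.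
\<close>

definition dual_schwartz_ZT :: "(int^'n \<Rightarrow> real^'n \<Rightarrow> complex) set" where
  "dual_schwartz_ZT = {\<sigma>.
     (\<forall>k. periodic (\<sigma> k)) \<and>
     (\<forall>G\<in>schwartz_ZT. integrable ztorus (\<lambda>(k, y). \<sigma> k y * G k y)) \<and>
     (\<exists>C j. \<forall>G\<in>schwartz_ZT. norm (LINT (k, y)|ztorus. \<sigma> k y * G k y) \<le> C * seminorm_ZT j G)}"

definition translation :: "int^'n \<Rightarrow> (int^'n \<Rightarrow> complex) \<Rightarrow> int^'n \<Rightarrow> complex" where
  "translation m g = (\<lambda>k. g (k - m))"

definition modulation :: "real^'n \<Rightarrow> (int^'n \<Rightarrow> complex) \<Rightarrow> int^'n \<Rightarrow> complex" where
  "modulation w g = (\<lambda>k. exp (2 * pi * \<i> * (w \<bullet> rvec k)) * g k)"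

definition stft :: "(int^'n \<Rightarrow> complex) \<Rightarrow> (int^'n \<Rightarrow> complex) \<Rightarrow> int^'n \<Rightarrow> real^'n \<Rightarrow> complex" where
  "stft g f m w = (\<Sum>\<^sub>\<infinity>k. f k * cnj (modulation w (translation m g) k))"

definition stft_ZT :: "(int^'n \<Rightarrow> real^'n \<Rightarrow> complex) \<Rightarrow> (int^'n \<Rightarrow> real^'n \<Rightarrow> complex) \<Rightarrow>
    int^'n \<Rightarrow> real^'n \<Rightarrow> real^'n \<Rightarrow> int^'n \<Rightarrow> complex" where
  "stft_ZT G \<sigma> m w x l = (\<Sum>\<^sub>\<infinity>k. LINT y|torus.
     \<sigma> k y * cnj (G (k - m) (y - w)) * exp (- 2 * pi * \<i> * (x \<bullet> rvec k + rvec l \<bullet> y)))"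

definition young_function :: "(ennreal \<Rightarrow> ennreal) \<Rightarrow> bool" where
  "young_function \<Phi> \<longleftrightarrow>
     (\<forall>x y. \<forall>t\<in>{0..1::real}.
        \<Phi> (ennreal t * x + ennreal (1 - t) * y) \<le> ennreal t * \<Phi> x + ennreal (1 - t) * \<Phi> y) \<and>
     \<Phi> 0 = 0 \<and> ((\<lambda>t::real. \<Phi> (ennreal t)) \<longlongrightarrow> \<infinity>) at_top \<and> \<Phi> \<infinity> = \<infinity>"

text \<open>
  The function \<open>-x\<^sup>2 ln x\<close> has second derivative \<open>-2 ln x - 3\<close> and is therefore convex exactly
  up to \<open>exp (-3/2)\<close>. The bound \<open>exp (-2/3)\<close> that is found in the literature is a misprint:
  no Young function satisfies it.
\<close>

lemma no_young_function_up_to_exp_minus_two_thirds: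
  assumes "young_function \<Phi>"
    and eq: "\<And>x. 0 \<le> x \<Longrightarrow> x \<le> exp (- 2 / 3) \<Longrightarrow> \<Phi> (ennreal x) = ennreal (- (x\<^sup>2 * ln x))"
  shows False
proof -
  define r :: real where "r = exp (- 2 / 3)"
  have r: "r > 0" "ln r = - 2 / 3" by (auto simp: r_def)
  have ln34: "ln (3/4::real) \<le> - 1 / 4" using ln_le_minus_one[of "3/4"] by simp
  have ln12: "ln (1/2::real) \<ge> - 25 / 36" using ln2_le_25_over_36 by (simp add: ln_div)
  have v: "\<Phi> (ennreal (r * q)) = ennreal (r\<^sup>2 * (q\<^sup>2 * (2 / 3 - ln q)))" if "0 < q" "q \<le> 1" for q
  proof -
    have "- ((r * q)\<^sup>2 * ln (r * q)) = r\<^sup>2 * (q\<^sup>2 * (2 / 3 - ln q))"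
      using r that by (simp add: ln_mult power_mult_distrib algebra_simps)
    moreover have "r * q \<le> r" using r that by simp
    ultimately show ?thesis using eq[of "r * q"] that r by (simp add: r_def)
  qed
  have comb: "ennreal a * ennreal x + ennreal b * ennreal y = ennreal (a * x + b * y)"
    if "a \<ge> 0" "b \<ge> 0" "x \<ge> 0" "y \<ge> 0" for a b x y :: real
    using that by (simp add: ennreal_mult'' ennreal_plus)
  have "\<Phi> (ennreal (1/2) * ennreal (r * 1) + ennreal (1 - 1/2) * ennreal (r * (1/2)))
      \<le> ennreal (1/2) * \<Phi> (ennreal (r * 1)) + ennreal (1 - 1/2) * \<Phi> (ennreal (r * (1/2)))"
  proof -
    have "\<forall>x y. \<forall>t\<in>{0..1::real}.
        \<Phi> (ennreal t * x + ennreal (1 - t) * y) \<le> ennreal t * \<Phi> x + ennreal (1 - t) * \<Phi> y"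
      using assms(1) unfolding young_function_def by blast
    moreover have "(1/2::real) \<in> {0..1}" by simp
    ultimately show ?thesis by blast
  qed
  also have "ennreal (1/2) * ennreal (r * 1) + ennreal (1 - 1/2) * ennreal (r * (1/2)) = ennreal (r * (3/4))"
    using r by (subst comb) (auto simp: field_simps)
  finally have *: "\<Phi> (ennreal (r * (3/4)))
      \<le> ennreal (1/2) * \<Phi> (ennreal (r * 1)) + ennreal (1 - 1/2) * \<Phi> (ennreal (r * (1/2)))" .
  have v34: "\<Phi> (ennreal (r * (3/4))) = ennreal (r\<^sup>2 * ((3/4)\<^sup>2 * (2/3 - ln (3/4))))"
    and v1: "\<Phi> (ennreal (r * 1)) = ennreal (r\<^sup>2 * (1\<^sup>2 * (2/3 - ln 1)))"
    and v12: "\<Phi> (ennreal (r * (1/2))) = ennreal (r\<^sup>2 * ((1/2)\<^sup>2 * (2/3 - ln (1/2))))"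
    by (rule v; simp)+
  have "ennreal (r\<^sup>2 * ((3/4)\<^sup>2 * (2/3 - ln (3/4))))
      \<le> ennreal (1/2) * ennreal (r\<^sup>2 * (1\<^sup>2 * (2/3 - ln 1)))
         + ennreal (1 - 1/2) * ennreal (r\<^sup>2 * ((1/2)\<^sup>2 * (2/3 - ln (1/2))))"
    using * unfolding v34 v1 v12 .
  also have "\<dots> = ennreal (1/2 * (r\<^sup>2 * (1\<^sup>2 * (2/3 - ln 1))) + (1 - 1/2) * (r\<^sup>2 * ((1/2)\<^sup>2 * (2/3 - ln (1/2)))))"
    by (rule comb) (auto simp: ln_div)
  finally have "r\<^sup>2 * ((3/4)\<^sup>2 * (2/3 - ln (3/4)))
      \<le> 1/2 * (r\<^sup>2 * (1\<^sup>2 * (2/3 - ln 1))) + (1 - 1/2) * (r\<^sup>2 * ((1/2)\<^sup>2 * (2/3 - ln (1/2))))"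
    by (subst (asm) ennreal_le_iff) (auto simp: ln_div intro!: add_nonneg_nonneg mult_nonneg_nonneg)
  also have "\<dots> = r\<^sup>2 * (1/3 + 1/8 * (2/3 - ln (1/2)))" by (simp add: power2_eq_square algebra_simps)
  finally have "(3/4)\<^sup>2 * (2/3 - ln (3/4::real)) \<le> 1/3 + 1/8 * (2/3 - ln (1/2))"
    using r by simp
  then have "9/16 * (2/3 - ln (3/4::real)) \<le> 1/3 + 1/8 * (2/3 - ln (1/2))"
    by (simp add: power2_eq_square)
  then show False using ln34 ln12 by (simp only: right_diff_distrib)
qed

definition orlicz_norm :: "(ennreal \<Rightarrow> ennreal) \<Rightarrow> (int^'n \<Rightarrow> real^'n \<Rightarrow> complex) \<Rightarrow> ennreal" where
  "orlicz_norm \<Phi> F = Inf {ennreal b | b. b > 0 \<and>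
     (\<integral>\<^sup>+m. \<integral>\<^sup>+w. \<Phi> (ennreal (norm (F m w) / b)) \<partial>torus \<partial>count_space UNIV) \<le> 1}"

definition modulation_norm :: "(int^'n \<Rightarrow> complex) \<Rightarrow> (ennreal \<Rightarrow> ennreal) \<Rightarrow> (int^'n \<Rightarrow> complex) \<Rightarrow> ennreal" where
  "modulation_norm g0 \<Phi> f = orlicz_norm \<Phi> (stft g0 f)"

definition modulation_space :: "(int^'n \<Rightarrow> complex) \<Rightarrow> (ennreal \<Rightarrow> ennreal) \<Rightarrow> (int^'n \<Rightarrow> complex) set" where
  "modulation_space g0 \<Phi> = {f \<in> dual_schwartz_Z. modulation_norm g0 \<Phi> f < \<infinity>}"

definition M1_norm :: "(int^'n \<Rightarrow> complex) \<Rightarrow> (int^'n \<Rightarrow> complex) \<Rightarrow> ennreal" where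
  "M1_norm g0 f = (\<integral>\<^sup>+m. \<integral>\<^sup>+w. ennreal (norm (stft g0 f m w)) \<partial>torus \<partial>count_space UNIV)"

definition M1_space :: "(int^'n \<Rightarrow> complex) \<Rightarrow> (int^'n \<Rightarrow> complex) set" where
  "M1_space g0 = {f \<in> dual_schwartz_Z. M1_norm g0 f < \<infinity>}"

text \<open>
  A different window yields an equivalent norm only; multiplying \<open>G\<close> by \<open>c > 0\<close> multiplies
  \<open>M1_norm_ZT G\<close> by \<open>c\<close>. A bound by \<open>M1_norm_ZT G \<sigma>\<close> with constant one therefore
  refers to a suitably scaled window.
\<close>

definition M1_norm_ZT :: "(int^'n \<Rightarrow> real^'n \<Rightarrow> complex) \<Rightarrow> (int^'n \<Rightarrow> real^'n \<Rightarrow> complex) \<Rightarrow> ennreal" where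
  "M1_norm_ZT G \<sigma> = (\<integral>\<^sup>+m. \<integral>\<^sup>+w. \<integral>\<^sup>+x. \<integral>\<^sup>+l. ennreal (norm (stft_ZT G \<sigma> m w x l))
     \<partial>count_space UNIV \<partial>torus \<partial>torus \<partial>count_space UNIV)"

definition M1_space_ZT :: "(int^'n \<Rightarrow> real^'n \<Rightarrow> complex) \<Rightarrow> (int^'n \<Rightarrow> real^'n \<Rightarrow> complex) set" where
  "M1_space_ZT G = {\<sigma> \<in> dual_schwartz_ZT. M1_norm_ZT G \<sigma> < \<infinity>}"

definition linf_norm :: "(int^'n \<Rightarrow> complex) \<Rightarrow> ennreal" where
  "linf_norm g = (SUP k. ennreal (norm (g k)))"

definition linf_space :: "(int^'n \<Rightarrow> complex) set" where
  "linf_space = {g. linf_norm g < \<infinity>}"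

definition operator_norm :: "(int^'n \<Rightarrow> complex) \<Rightarrow> (ennreal \<Rightarrow> ennreal) \<Rightarrow>
    ((int^'n \<Rightarrow> complex) \<Rightarrow> (int^'n \<Rightarrow> complex)) \<Rightarrow> ennreal" where
  "operator_norm g0 \<Phi> T =
     (SUP f \<in> {f \<in> modulation_space g0 \<Phi>. modulation_norm g0 \<Phi> f \<le> 1}. modulation_norm g0 \<Phi> (T f))"

definition bounded_operator :: "(int^'n \<Rightarrow> complex) \<Rightarrow> (ennreal \<Rightarrow> ennreal) \<Rightarrow>
    ((int^'n \<Rightarrow> complex) \<Rightarrow> (int^'n \<Rightarrow> complex)) \<Rightarrow> bool" where
  "bounded_operator g0 \<Phi> T \<longleftrightarrow>
     (\<forall>f\<in>modulation_space g0 \<Phi>. T f \<in> modulation_space g0 \<Phi>) \<and>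
     (\<forall>f\<in>modulation_space g0 \<Phi>. \<forall>h\<in>modulation_space g0 \<Phi>. T (\<lambda>k. f k + h k) = (\<lambda>k. T f k + T h k)) \<and>
     (\<forall>f\<in>modulation_space g0 \<Phi>. \<forall>c. T (\<lambda>k. c * f k) = (\<lambda>k. c * T f k)) \<and>
     operator_norm g0 \<Phi> T < \<infinity>"

text \<open>
  The second predicate says that the sum and the integrals in the first definition converge
  absolutely, so that \<open>localization\<close> is not a default value.
\<close>

definition localization :: "(int^'n \<Rightarrow> real^'n \<Rightarrow> complex) \<Rightarrow> (int^'n \<Rightarrow> complex) \<Rightarrow> (int^'n \<Rightarrow> complex) \<Rightarrow>
    (int^'n \<Rightarrow> complex) \<Rightarrow> int^'n \<Rightarrow> complex" where
  "localization \<sigma> g1 g2 f k =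
     (\<Sum>\<^sub>\<infinity>m. LINT w|torus. \<sigma> m w * stft g1 f m w * modulation w (translation m g2) k)"

definition localization_converges :: "(int^'n \<Rightarrow> real^'n \<Rightarrow> complex) \<Rightarrow> (int^'n \<Rightarrow> complex) \<Rightarrow>
    (int^'n \<Rightarrow> complex) \<Rightarrow> (int^'n \<Rightarrow> complex) \<Rightarrow> bool" where
  "localization_converges \<sigma> g1 g2 f \<longleftrightarrow>
     (\<forall>m w. (\<lambda>k. f k * cnj (modulation w (translation m g1) k)) summable_on UNIV) \<and>
     (\<forall>k. integrable ztorus (\<lambda>(m, w). \<sigma> m w * stft g1 f m w * modulation w (translation m g2) k))"

end

(*
  On Z^n x T^n the short-time Fourier transform at a fixed time m is a Fourier series with
  coefficients f(k) * conj(g0(k - m)). Bounding the series by its coefficients, and the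
  coefficients by the L^1 norm of the series, makes the modulation norms equivalent to the
  sequence norms: M^Phi ~ l^Phi and M^1 ~ l^1, with constants that depend on g0 only. The
  same comparison on Z^n x T^n, together with the fact that the L^1 norm on the torus is at
  most the l^1 norm of the Fourier coefficients, gives ||sigma||_{L^1} <= C ||sigma||_{M^1}.

  Now |L f(k)| <= sum_j K(k,j) |f(j)| where
  K(k,j) = sum_m (int |sigma(m,w)| dw) |g1(j-m)| |g2(k-m)|. The row sums of K are at most
  ||sigma||_{L^1} ||g1||_1 ||g2||_oo and the column sums at most
  ||sigma||_{L^1} ||g1||_oo ||g2||_1, so that Schur's test, run through the convexity of Phi,
  bounds L on l^Phi. All constants go into the scaling of the window G.
*)

theory Submission
  imports Defs
begin

text \<open>Every comparison is made between modulars: a modular at a scaled parameter is bounded by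
  a modular at \<open>b\<close>, and only \<open>orlicz_norm_le_mult\<close> returns to norms.
  Jensen's inequality enters three times, each time with a loss of 2, whence the 8 in
  \<open>8 * A * B / norm (g0 k0)\<close>: in passing from a sequence to its transform
  (\<open>A\<close> bounds the l^1 norm of \<open>g0\<close>), in Schur's test (with bound
  \<open>B\<close>), and in reading off coefficients with the help of a point \<open>k0\<close>
  where \<open>g0\<close> does not vanish. Replacing the l^1 norms of \<open>g1\<close> and
  \<open>g2\<close> by M^1 norms costs another 1/|g0(k0)|. Hence the window is scaled so that one
  slice \<open>G k1\<close> has L^1 norm 8A/|g0(k0)|^2, a condition on \<open>g0\<close> and
  \<open>G0\<close> only.

  The delicate step is the bound of an L^1 norm by Fourier coefficients. The slices of
  \<open>\<sigma>\<close> are merely integrable, so expanding them in Fourier series would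
  presuppose the uniqueness theorem. Instead the L^1 norm is computed by duality, with test
  functions approximated by trigonometric polynomials.\<close>

section \<open>Sums and Young functions\<close>

text \<open>Complex families are summable only absolutely, and both sides default to 0 when that
  fails. The integral form makes Fubini and dominated estimates available for sums.\<close>

lemma infsum_eq_integral_count_space:
  fixes f :: "'a \<Rightarrow> complex"
  shows "(\<Sum>\<^sub>\<infinity>k. f k) = (LINT k|count_space UNIV. f k)"
proof (cases "integrable (count_space UNIV) f")
  case True
  then have "Infinite_Set_Sum.abs_summable_on f UNIV"
    by (simp add: Infinite_Set_Sum.abs_summable_on_def)
  then show ?thesis
    by (metis infsetsum_def infsetsum_infsum)
next
  case False
  then have "\<not> f summable_on UNIV"
    by (metis Infinite_Set_Sum.abs_summable_on_def abs_summable_equivalent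
        summable_on_iff_abs_summable_on_complex)
  with False show ?thesis
    by (simp add: infsum_not_exists not_integrable_integral_eq)
qed

lemma summable_on_iff_integrable_count_space:
  fixes f :: "'a \<Rightarrow> complex"
  shows "f summable_on UNIV \<longleftrightarrow> integrable (count_space UNIV) f"
  by (metis Infinite_Set_Sum.abs_summable_on_def abs_summable_equivalent
      summable_on_iff_abs_summable_on_complex)

lemma norm_infsum_le_nn_integral:
  fixes f :: "'a \<Rightarrow> complex"
  shows "ennreal (norm (\<Sum>\<^sub>\<infinity>k. f k)) \<le> (\<integral>\<^sup>+k. ennreal (norm (f k)) \<partial>count_space UNIV)"
  unfolding infsum_eq_integral_count_space
  by (cases "integrable (count_space UNIV) f")
    (auto simp: integral_norm_bound_ennreal not_integrable_integral_eq)

lemma le_nn_integral_count_space: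
  "f k \<le> (\<integral>\<^sup>+k. f k \<partial>count_space UNIV)"
proof -
  have "f k = (\<integral>\<^sup>+j. f j * indicator {k} j \<partial>count_space UNIV)"
    by (simp add: nn_integral_count_space_indicator[symmetric] nn_integral_count_space_finite)
  also have "\<dots> \<le> (\<integral>\<^sup>+k. f k \<partial>count_space UNIV)"
    by (intro nn_integral_mono) (simp add: indicator_def)
  finally show ?thesis .
qed

lemma nn_integral_count_space_swap:
  fixes f :: "'a::countable \<Rightarrow> 'b \<Rightarrow> ennreal"
  shows "(\<integral>\<^sup>+x. \<integral>\<^sup>+y. f x y \<partial>count_space UNIV \<partial>count_space UNIV) =
    (\<integral>\<^sup>+y. \<integral>\<^sup>+x. f x y \<partial>count_space UNIV \<partial>count_space UNIV)"
  by (rule nn_integral_count_space_nn_integral[symmetric]) auto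

lemma nn_integral_count_space_diff:
  fixes f :: "'a::group_add \<Rightarrow> ennreal"
  shows "(\<integral>\<^sup>+k. f (k - m) \<partial>count_space UNIV) = (\<integral>\<^sup>+k. f k \<partial>count_space UNIV)"
    "(\<integral>\<^sup>+k. f (m - k) \<partial>count_space UNIV) = (\<integral>\<^sup>+k. f k \<partial>count_space UNIV)"
proof -
  have "bij_betw (\<lambda>k. k - m) UNIV UNIV"
    by (rule bij_betwI[where g = "\<lambda>k. k + m"]) auto
  then show "(\<integral>\<^sup>+k. f (k - m) \<partial>count_space UNIV) = (\<integral>\<^sup>+k. f k \<partial>count_space UNIV)"
    by (rule nn_integral_bij_count_space)
  have "bij_betw (\<lambda>k. m - k) UNIV UNIV"
    by (rule bij_betwI[where g = "\<lambda>k. - k + m"]) (auto simp: algebra_simps)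
  then show "(\<integral>\<^sup>+k. f (m - k) \<partial>count_space UNIV) = (\<integral>\<^sup>+k. f k \<partial>count_space UNIV)"
    by (rule nn_integral_bij_count_space)
qed

text \<open>Convexity on the segment from 0 to \<open>x\<close>, where \<open>\<Phi> 0 = 0\<close>,
  makes Phi(t)/t nondecreasing. The multiplied form stays meaningful when Phi is infinite at
  \<open>x\<close>.\<close>

lemma young_scaled_mono:
  assumes "young_function \<Phi>" "0 < t" "t \<le> x"
  shows "\<Phi> (ennreal t) \<le> ennreal (t / x) * \<Phi> (ennreal x)"
proof -
  have conv: "\<forall>x y. \<forall>t\<in>{0..1::real}.
        \<Phi> (ennreal t * x + ennreal (1 - t) * y) \<le> ennreal t * \<Phi> x + ennreal (1 - t) * \<Phi> y"
    and zero: "\<Phi> 0 = 0"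
    using assms(1) unfolding young_function_def by blast+
  have "t / x \<in> {0..1}" using assms(2,3) by auto
  then have "\<Phi> (ennreal (t / x) * ennreal x + ennreal (1 - t / x) * 0)
      \<le> ennreal (t / x) * \<Phi> (ennreal x) + ennreal (1 - t / x) * \<Phi> 0"
    using conv by blast
  moreover have "ennreal (t / x) * ennreal x = ennreal t"
    using assms(2,3) by (simp add: ennreal_mult'[symmetric])
  ultimately show ?thesis by (simp add: zero)
qed

lemma young_mono:
  assumes "young_function \<Phi>" "0 \<le> t" "t \<le> x"
  shows "\<Phi> (ennreal t) \<le> \<Phi> (ennreal x)"
proof (cases "t = 0")
  case True
  then show ?thesis using assms(1) by (simp add: young_function_def)
next
  case False
  then have "\<Phi> (ennreal t) \<le> ennreal (t / x) * \<Phi> (ennreal x)"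
    using assms by (intro young_scaled_mono) auto
  also have "\<dots> \<le> 1 * \<Phi> (ennreal x)"
    using False assms by (intro mult_right_mono) (auto simp: ennreal_le_1)
  finally show ?thesis by simp
qed

text \<open>
  Jensen's inequality up to a factor 2. The loss spares all case distinctions about where \<open>\<Phi>\<close>
  is infinite: convexity enters only through \<open>\<Phi> x \<ge> \<Phi> t / t * (x - t)\<close>.
\<close>

lemma young_jensen:
  assumes \<Phi>: "young_function \<Phi>"
    and [measurable]: "p \<in> borel_measurable M" "X \<in> borel_measurable M"
    and p: "(\<integral>\<^sup>+x. p x \<partial>M) \<le> 1"
    and X: "\<And>x. 0 \<le> X x"
    and t: "0 \<le> t" "ennreal (2 * t) \<le> (\<integral>\<^sup>+x. p x * ennreal (X x) \<partial>M)"
  shows "\<Phi> (ennreal t) \<le> (\<integral>\<^sup>+x. p x * \<Phi> (ennreal (X x)) \<partial>M)"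
proof (cases "t = 0")
  case True
  then show ?thesis using \<Phi> by (simp add: young_function_def)
next
  case False
  with t have "t > 0" by simp
  \<comment> \<open>Only the excess of \<open>X\<close> over \<open>t\<close> is kept. As the weight
    has mass at most 1, the excess still integrates to at least 2t - t = t; this is what the factor
    2 pays for.\<close>
  define Y where "Y x = max 0 (X x - t)" for x
  have [measurable]: "Y \<in> borel_measurable M" unfolding Y_def by measurable
  have Y: "0 \<le> Y x" for x by (simp add: Y_def)
  have "ennreal t + ennreal t = ennreal (2 * t)" using t by (simp flip: ennreal_plus)
  also have "\<dots> \<le> (\<integral>\<^sup>+x. p x * ennreal (X x) \<partial>M)" by (rule t)
  also have "\<dots> \<le> (\<integral>\<^sup>+x. p x * ennreal (Y x) + ennreal t * p x \<partial>M)"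
  proof (rule nn_integral_mono)
    fix x
    have "ennreal (X x) \<le> ennreal (Y x) + ennreal t"
      using t Y by (simp flip: ennreal_plus add: Y_def)
    then have "p x * ennreal (X x) \<le> p x * (ennreal (Y x) + ennreal t)"
      by (rule mult_left_mono) simp
    then show "p x * ennreal (X x) \<le> p x * ennreal (Y x) + ennreal t * p x"
      by (simp add: distrib_left mult.commute)
  qed
  also have "\<dots> = (\<integral>\<^sup>+x. p x * ennreal (Y x) \<partial>M) + ennreal t * (\<integral>\<^sup>+x. p x \<partial>M)"
    by (subst nn_integral_add) (auto simp: nn_integral_cmult)
  also have "\<dots> \<le> (\<integral>\<^sup>+x. p x * ennreal (Y x) \<partial>M) + ennreal t * 1"
    using p by (intro add_left_mono mult_left_mono) auto
  finally have "ennreal t + ennreal t \<le> ennreal t + (\<integral>\<^sup>+x. p x * ennreal (Y x) \<partial>M)"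
    by (metis add.commute mult.right_neutral)
  then have tY: "ennreal t \<le> (\<integral>\<^sup>+x. p x * ennreal (Y x) \<partial>M)"
    by (auto simp: ennreal_add_left_cancel_le)
  \<comment> \<open>Slopes c/t with finite c stand in for Phi(t)/t, so that an infinite Phi(t) is
    reached by letting c grow.\<close>
  have *: "ennreal c \<le> (\<integral>\<^sup>+x. p x * \<Phi> (ennreal (X x)) \<partial>M)"
    if c: "0 \<le> c" "ennreal c \<le> \<Phi> (ennreal t)" for c
  proof -
    have "ennreal c = ennreal (c / t) * ennreal t"
      using c \<open>t > 0\<close> by (simp add: ennreal_mult'[symmetric])
    also have "\<dots> \<le> ennreal (c / t) * (\<integral>\<^sup>+x. p x * ennreal (Y x) \<partial>M)"
      by (rule mult_left_mono[OF tY]) simp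
    also have "\<dots> = (\<integral>\<^sup>+x. ennreal (c / t) * (p x * ennreal (Y x)) \<partial>M)"
      by (simp add: nn_integral_cmult)
    also have "\<dots> \<le> (\<integral>\<^sup>+x. p x * \<Phi> (ennreal (X x)) \<partial>M)"
    proof (rule nn_integral_mono)
      fix x
      have "ennreal (c / t * Y x) \<le> \<Phi> (ennreal (X x))"
      proof (cases "t \<le> X x")
        case True
        have "c / t * Y x \<le> c / t * X x"
          using True \<open>t > 0\<close> c by (intro mult_left_mono) (auto simp: Y_def)
        then have "ennreal (c / t * Y x) \<le> ennreal (c / t * X x)" by (rule ennreal_leI)
        also have "\<dots> = ennreal (X x / t) * ennreal c"
          using True \<open>t > 0\<close> c by (subst ennreal_mult'[symmetric]) (auto simp: mult.commute)
        also have "\<dots> \<le> ennreal (X x / t) * (ennreal (t / X x) * \<Phi> (ennreal (X x)))"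
          using young_scaled_mono[OF \<Phi> \<open>t > 0\<close> True] c by (intro mult_left_mono) auto
        also have "\<dots> = \<Phi> (ennreal (X x))"
          using True \<open>t > 0\<close> by (simp add: ennreal_mult'[symmetric] mult.assoc[symmetric])
        finally show ?thesis .
      qed (simp add: Y_def)
      then have "p x * ennreal (c / t * Y x) \<le> p x * \<Phi> (ennreal (X x))"
        by (rule mult_left_mono) simp
      then show "ennreal (c / t) * (p x * ennreal (Y x)) \<le> p x * \<Phi> (ennreal (X x))"
        using c \<open>t > 0\<close> Y by (subst (asm) ennreal_mult) (auto simp: mult.left_commute)
    qed
    finally show ?thesis .
  qed
  show ?thesis
  proof (cases "\<Phi> (ennreal t)")
    case (real r)
    then show ?thesis using *[of r] by simp
  next
    case top
    have "ennreal (real n) \<le> (\<integral>\<^sup>+x. p x * \<Phi> (ennreal (X x)) \<partial>M)" for n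
      by (rule *) (auto simp: top)
    then have "(\<integral>\<^sup>+x. p x * \<Phi> (ennreal (X x)) \<partial>M) = top"
      by (metis ennreal_Ex_less_of_nat ennreal_of_nat_eq_real_of_nat leD top.not_eq_extremum)
    then show ?thesis by simp
  qed
qed

text \<open>Division by \<open>B\<close> turns each row of \<open>K\<close> into a weight of mass at
  most 1, to which \<open>young_jensen\<close> applies for each \<open>k\<close>; the column bound
  enters after the two sums are exchanged. The 2 is the loss in \<open>young_jensen\<close>.\<close>

lemma young_schur:
  fixes K :: "'a::countable \<Rightarrow> 'b \<Rightarrow> ennreal"
  assumes \<Phi>: "young_function \<Phi>"
    and B: "0 < B" and b: "0 < b"
    and rows: "\<And>k. (\<integral>\<^sup>+j. K k j \<partial>count_space UNIV) \<le> ennreal B"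
    and cols: "\<And>j. (\<integral>\<^sup>+k. K k j \<partial>count_space UNIV) \<le> ennreal B"
    and f: "\<And>j. 0 \<le> f j"
    and h: "\<And>k. 0 \<le> h k" "\<And>k. ennreal (h k) \<le> (\<integral>\<^sup>+j. K k j * ennreal (f j) \<partial>count_space UNIV)"
  shows "(\<integral>\<^sup>+k. \<Phi> (ennreal (h k / (2 * B * b))) \<partial>count_space UNIV) \<le>
    (\<integral>\<^sup>+j. \<Phi> (ennreal (f j / b)) \<partial>count_space UNIV)"
proof -
  define p where "p k j = ennreal (1 / B) * K k j" for k j
  have BB: "ennreal (1 / B) * ennreal B = 1"
    using B by (simp add: ennreal_mult'[symmetric])
  have prow: "(\<integral>\<^sup>+j. p k j \<partial>count_space UNIV) \<le> 1" for k
    using mult_left_mono[OF rows[of k], of "ennreal (1 / B)"] BB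
    by (simp add: p_def nn_integral_cmult)
  have pcol: "(\<integral>\<^sup>+k. p k j \<partial>count_space UNIV) \<le> 1" for j
    using mult_left_mono[OF cols[of j], of "ennreal (1 / B)"] BB
    by (simp add: p_def nn_integral_cmult)
  have "\<Phi> (ennreal (h k / (2 * B * b))) \<le> (\<integral>\<^sup>+j. p k j * \<Phi> (ennreal (f j / b)) \<partial>count_space UNIV)" for k
  proof (rule young_jensen[OF \<Phi> _ _ prow])
    have "ennreal (2 * (h k / (2 * B * b))) = ennreal (1 / (B * b)) * ennreal (h k)"
      using h B b by (simp add: ennreal_mult'[symmetric])
    also have "\<dots> \<le> ennreal (1 / (B * b)) * (\<integral>\<^sup>+j. K k j * ennreal (f j) \<partial>count_space UNIV)"
      by (intro mult_left_mono h) simp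
    also have "\<dots> = (\<integral>\<^sup>+j. p k j * ennreal (f j / b) \<partial>count_space UNIV)"
    proof -
      have "ennreal (1 / (B * b)) * (K k j * ennreal (f j)) = p k j * ennreal (f j / b)" for j
      proof -
        have "ennreal (1 / (B * b)) * ennreal (f j) = ennreal (1 / B) * ennreal (f j / b)"
          using f B b by (simp add: ennreal_mult'[symmetric])
        then show ?thesis by (simp add: p_def mult_ac) (metis mult.assoc mult.commute)
      qed
      then show ?thesis by (simp add: nn_integral_cmult[symmetric])
    qed
    finally show "ennreal (2 * (h k / (2 * B * b)))
        \<le> (\<integral>\<^sup>+j. p k j * ennreal (f j / b) \<partial>count_space UNIV)" .
  qed (use h f B b in auto)
  then have "(\<integral>\<^sup>+k. \<Phi> (ennreal (h k / (2 * B * b))) \<partial>count_space UNIV)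
      \<le> (\<integral>\<^sup>+k. \<integral>\<^sup>+j. p k j * \<Phi> (ennreal (f j / b)) \<partial>count_space UNIV \<partial>count_space UNIV)"
    by (intro nn_integral_mono)
  also have "\<dots> = (\<integral>\<^sup>+j. \<integral>\<^sup>+k. p k j * \<Phi> (ennreal (f j / b)) \<partial>count_space UNIV \<partial>count_space UNIV)"
    by (rule nn_integral_count_space_swap)
  also have "\<dots> = (\<integral>\<^sup>+j. (\<integral>\<^sup>+k. p k j \<partial>count_space UNIV) * \<Phi> (ennreal (f j / b)) \<partial>count_space UNIV)"
    by (simp add: nn_integral_multc)
  also have "\<dots> \<le> (\<integral>\<^sup>+j. 1 * \<Phi> (ennreal (f j / b)) \<partial>count_space UNIV)"
    by (intro nn_integral_mono mult_right_mono pcol) simp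
  finally show ?thesis by simp
qed

section \<open>Integration over the torus\<close>

lemma sets_torus [measurable_cong]: "sets (torus :: (real^'n) measure) = sets (restrict_space borel (cbox 0 1))"
  by (simp add: torus_def sets_restrict_space)

lemma space_torus [simp]: "space (torus :: (real^'n) measure) = cbox 0 1"
  by (simp add: torus_def space_restrict_space)

lemma borel_measurable_torus:
  assumes "f \<in> borel_measurable borel"
  shows "f \<in> borel_measurable (torus :: (real^'n) measure)"
  using assms by (simp add: torus_def measurable_restrict_space1)

lemma continuous_imp_measurable_torus:
  fixes f :: "real^'n \<Rightarrow> 'b::topological_space"
  assumes "continuous_on UNIV f"
  shows "f \<in> borel_measurable torus"
  using assms by (intro borel_measurable_torus borel_measurable_continuous_onI)

lemma emeasure_torus [simp]: "emeasure (torus :: (real^'n) measure) (cbox 0 1) = 1"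
proof -
  have "(1 :: real^'n) \<bullet> b = 1" if "b \<in> Basis" for b
    using that by (auto simp: Basis_vec_def inner_axis one_vec_def)
  then show ?thesis
    by (simp add: torus_def emeasure_restrict_space emeasure_lborel_cbox_eq)
qed

lemma measure_torus [simp]: "measure (torus :: (real^'n) measure) (cbox 0 1) = 1"
  by (simp add: measure_def)

interpretation torus: finite_measure "torus :: (real^'n) measure"
  by standard simp

lemma nn_integral_torus:
  "(\<integral>\<^sup>+w. f w \<partial>(torus :: (real^'n) measure)) = (\<integral>\<^sup>+w. f w * indicator (cbox 0 1) w \<partial>lborel)"
  by (simp add: torus_def nn_integral_restrict_space)

text \<open>The half-open cube, unlike the closed one, tiles the space.\<close>

definition half_cube :: "(real^'n) set" where
  "half_cube = {x. \<forall>i. 0 \<le> x $ i \<and> x $ i < 1}"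

lemma half_cube_measurable [measurable]: "half_cube \<in> sets borel"
  unfolding half_cube_def by measurable

lemma rvec_simps [simp]:
  "rvec 0 = 0" "rvec (k + l) = rvec k + rvec l" "rvec (k - l) = rvec k - rvec l" "rvec (- k) = - rvec k"
  by (auto simp: rvec_def vec_eq_iff)

lemma half_cube_translate_iff:
  "y - rvec l \<in> half_cube \<longleftrightarrow> l = (\<chi> i. \<lfloor>y $ i\<rfloor>)"
proof -
  have "y - rvec l \<in> half_cube \<longleftrightarrow> (\<forall>i. \<lfloor>y $ i\<rfloor> = l $ i)"
    unfolding half_cube_def rvec_def floor_eq_iff by (auto simp: diff_less_eq add.commute)
  then show ?thesis by (auto simp: vec_eq_iff)
qed

lemma half_cube_tiles:
  "(\<integral>\<^sup>+l. indicator half_cube (y - rvec l) \<partial>count_space UNIV) = (1 :: ennreal)"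
proof -
  have "(\<lambda>l. indicator half_cube (y - rvec l)) = (indicator {\<chi> i. \<lfloor>y $ i\<rfloor>} :: _ \<Rightarrow> ennreal)"
    by (auto simp: fun_eq_iff indicator_def half_cube_translate_iff)
  then show ?thesis by simp
qed

lemma AE_lborel_not_boundary: "AE w in lborel. w \<notin> cbox 0 1 - box (0::real^'n) 1"
proof (rule AE_not_in)
  have "emeasure lborel (cbox 0 1 - box (0::real^'n) 1) = 0"
    by (subst emeasure_Diff)
      (auto simp: box_subset_cbox emeasure_lborel_cbox_eq emeasure_lborel_box_eq Basis_vec_def inner_axis)
  then show "cbox 0 1 - box (0::real^'n) 1 \<in> null_sets lborel" by auto
qed

lemma nn_integral_torus_half_cube:
  fixes f :: "real^'n \<Rightarrow> ennreal"
  shows "(\<integral>\<^sup>+w. f w \<partial>torus) = (\<integral>\<^sup>+w. f w * indicator half_cube w \<partial>lborel)"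
proof -
  have "AE w in lborel. f w * indicator (cbox 0 1) w = f w * indicator half_cube w"
    using AE_lborel_not_boundary
    by eventually_elim
      (auto simp: indicator_def half_cube_def mem_box_cart dest: less_imp_le)
  then show ?thesis
    unfolding nn_integral_torus by (rule nn_integral_cong_AE)
qed

lemma nn_integral_lborel_translate:
  fixes f :: "'a::euclidean_space \<Rightarrow> ennreal"
  assumes [measurable]: "f \<in> borel_measurable borel"
  shows "(\<integral>\<^sup>+x. f (a + x) \<partial>lborel) = (\<integral>\<^sup>+x. f x \<partial>lborel)"
    and "(\<integral>\<^sup>+x. f (a - x) \<partial>lborel) = (\<integral>\<^sup>+x. f x \<partial>lborel)"
proof -
  show "(\<integral>\<^sup>+x. f (a + x) \<partial>lborel) = (\<integral>\<^sup>+x. f x \<partial>lborel)"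
    by (subst (2) lborel_affine[of 1 a]) (simp_all add: nn_integral_distr density_1)
  show "(\<integral>\<^sup>+x. f (a - x) \<partial>lborel) = (\<integral>\<^sup>+x. f x \<partial>lborel)"
    by (subst (2) lborel_affine[of "- 1" a]) (simp_all add: nn_integral_distr density_1)
qed

text \<open>The translates of \<open>half_cube\<close> form a partition of unity. Inserting it
  splits the reflected cube into pieces, periodicity moves each piece by an integer vector into the
  original cube, and there the pieces again add up to 1.\<close>

lemma nn_integral_torus_reflect:
  fixes f :: "real^'n \<Rightarrow> ennreal"
  assumes f [measurable]: "f \<in> borel_measurable borel" and per: "periodic f"
  shows "(\<integral>\<^sup>+w. f (a - w) \<partial>torus) = (\<integral>\<^sup>+w. f w \<partial>torus)"
proof -
  let ?Q = "half_cube :: (real^'n) set"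
  have "(\<integral>\<^sup>+w. f (a - w) \<partial>torus) = (\<integral>\<^sup>+w. f (a - w) * indicator ?Q (a - (a - w)) \<partial>lborel)"
    by (simp add: nn_integral_torus_half_cube)
  also have "\<dots> = (\<integral>\<^sup>+w. f w * indicator ?Q (a - w) \<partial>lborel)"
    by (rule nn_integral_lborel_translate(2)[where f = "\<lambda>w. f w * indicator ?Q (a - w)"]) simp
  also have "\<dots> = (\<integral>\<^sup>+w. \<integral>\<^sup>+l. f w * indicator ?Q (a - w) * indicator ?Q (w - rvec l) \<partial>count_space UNIV \<partial>lborel)"
    by (simp add: nn_integral_cmult half_cube_tiles)
  also have "\<dots> = (\<integral>\<^sup>+l. \<integral>\<^sup>+w. f w * indicator ?Q (a - w) * indicator ?Q (w - rvec l) \<partial>lborel \<partial>count_space UNIV)"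
    by (rule nn_integral_count_space_nn_integral) auto
  also have "\<dots> = (\<integral>\<^sup>+l. \<integral>\<^sup>+w. f w * indicator ?Q w * indicator ?Q (a - w - rvec l) \<partial>lborel \<partial>count_space UNIV)"
  proof (rule nn_integral_cong)
    fix l :: "int^'n"
    have "(\<integral>\<^sup>+w. f w * indicator ?Q (a - w) * indicator ?Q (w - rvec l) \<partial>lborel)
        = (\<integral>\<^sup>+w. f (rvec l + w) * indicator ?Q (a - (rvec l + w)) * indicator ?Q (rvec l + w - rvec l) \<partial>lborel)"
      by (rule nn_integral_lborel_translate(1)[symmetric,
            where f = "\<lambda>w. f w * indicator ?Q (a - w) * indicator ?Q (w - rvec l)"]) simp
    also have "\<dots> = (\<integral>\<^sup>+w. f w * indicator ?Q w * indicator ?Q (a - w - rvec l) \<partial>lborel)"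
      using per by (intro nn_integral_cong) (auto simp: periodic_def add.commute algebra_simps)
    finally show "(\<integral>\<^sup>+w. f w * indicator ?Q (a - w) * indicator ?Q (w - rvec l) \<partial>lborel)
        = (\<integral>\<^sup>+w. f w * indicator ?Q w * indicator ?Q (a - w - rvec l) \<partial>lborel)" .
  qed
  also have "\<dots> = (\<integral>\<^sup>+w. \<integral>\<^sup>+l. f w * indicator ?Q w * indicator ?Q (a - w - rvec l) \<partial>count_space UNIV \<partial>lborel)"
    by (rule nn_integral_count_space_nn_integral[symmetric]) auto
  also have "\<dots> = (\<integral>\<^sup>+w. f w \<partial>torus)"
    by (simp add: nn_integral_cmult half_cube_tiles nn_integral_torus_half_cube)
  finally show ?thesis .
qed

text \<open>Reflection at \<open>a\<close> exchanges 1 + u and 1 - u, so both have the same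
  integral. The added 1 makes the integrands nonnegative, as
  \<open>nn_integral_torus_reflect\<close> is about nonnegative functions.\<close>

lemma integral_torus_eq_0:
  fixes u :: "real^'n \<Rightarrow> real"
  assumes [measurable]: "u \<in> borel_measurable borel" and per: "periodic u"
    and bound: "\<And>y. \<bar>u y\<bar> \<le> 1" and odd: "\<And>y. u (a - y) = - u y"
  shows "(LINT y|torus. u y) = 0"
proof -
  have int: "integrable torus u"
    using bound by (intro torus.integrable_const_bound[of _ 1] AE_I2 borel_measurable_torus) auto
  have nonneg: "0 \<le> 1 + u y" "0 \<le> 1 - u y" for y
    using bound[of y] by (auto simp: abs_le_iff)
  have "(\<integral>\<^sup>+y. ennreal (1 + u (a - y)) \<partial>torus) = (\<integral>\<^sup>+y. ennreal (1 + u y) \<partial>torus)"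
    using per by (intro nn_integral_torus_reflect[where f = "\<lambda>y. ennreal (1 + u y)"])
      (auto simp: periodic_def)
  moreover have "(\<integral>\<^sup>+y. ennreal (1 + u y) \<partial>torus) = ennreal (LINT y|torus. 1 + u y)"
    using nonneg int by (intro nn_integral_eq_integral) auto
  moreover have "(\<integral>\<^sup>+y. ennreal (1 + u (a - y)) \<partial>torus) = ennreal (LINT y|torus. 1 - u y)"
    using nonneg int unfolding odd by (subst nn_integral_eq_integral) auto
  moreover have "0 \<le> (LINT y|torus. 1 - u y)" "0 \<le> (LINT y|torus. 1 + u y)"
    using nonneg by (auto intro!: integral_nonneg)
  ultimately have "(LINT y|torus. 1 - u y) = (LINT y|torus. 1 + u y)" by simp
  then show ?thesis using int by (simp add: measure_def)
qed

section \<open>Characters of the torus and their orthogonality\<close>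

definition character :: "int^'n \<Rightarrow> real^'n \<Rightarrow> complex" where
  "character l y = cis (2 * pi * (y \<bullet> rvec l))"

lemma character_add: "character (k + l) y = character k y * character l y"
  by (simp add: character_def cis_mult inner_add_right distrib_left)

lemma character_0 [simp]: "character 0 y = 1"
  by (simp add: character_def)

lemma norm_character [simp]: "norm (character l y) = 1"
  by (simp add: character_def)

lemma character_cnj: "cnj (character l y) = character (- l) y"
  by (simp add: character_def cis_cnj)

lemma continuous_on_character [continuous_intros]: "continuous_on A (character l)"
  unfolding character_def by (intro continuous_intros)

lemma character_borel [measurable]: "character l \<in> borel_measurable borel"
  by (intro borel_measurable_continuous_onI continuous_intros)

lemma character_torus [measurable]: "character l \<in> borel_measurable torus"
  by (intro borel_measurable_torus) simp

lemma exp_eq_character: "exp (2 * complex_of_real pi * \<i> * complex_of_real (w \<bullet> rvec k)) = character k w"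
  by (simp add: character_def cis_conv_exp mult_ac)

lemma inner_rvec_rvec_Ints: "rvec k \<bullet> rvec l \<in> \<int>"
  by (auto simp: inner_vec_def rvec_def intro!: Ints_sum)

lemma character_periodic: "character l (y + rvec k) = character l y"
proof -
  have "cis (2 * pi * (rvec k \<bullet> rvec l)) = 1"
    by (metis inner_rvec_rvec_Ints cis_multiple_2pi)
  then show ?thesis
    by (simp add: character_def inner_add_left distrib_left cis_mult[symmetric])
qed

lemma integral_character:
  fixes l :: "int^'n"
  shows "(LINT y|torus. character l y) = of_bool (l = 0)"
proof (cases "l = 0")
  case False
  then obtain i where i: "l $ i \<noteq> 0" by (auto simp: vec_eq_iff)
  have per: "periodic (\<lambda>y. Re (character l y))" "periodic (\<lambda>y. Im (character l y))"
    by (auto simp: periodic_def character_periodic)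
  have int: "integrable torus (character l)"
    by (intro torus.integrable_const_bound[of _ 1] AE_I2) auto
  have "(LINT y|torus. Re (character l y)) = 0"
  \<comment> \<open>The inner product of this vector with \<open>rvec l\<close> is 1/2, which shifts
    the phase by pi: cos(pi - t) = - cos t. For the imaginary part the oddness of the sine suffices,
    with \<open>a = 0\<close>.\<close>
  proof (rule integral_torus_eq_0[OF _ per(1), where a = "axis i (1 / (2 * real_of_int (l $ i)))"])
    fix y :: "real^'n"
    have "2 * pi * ((axis i (1 / (2 * real_of_int (l $ i))) - y) \<bullet> rvec l) = pi - 2 * pi * (y \<bullet> rvec l)"
      using i by (simp add: inner_diff_left inner_axis' rvec_def right_diff_distrib)
    then show "Re (character l (axis i (1 / (2 * real_of_int (l $ i))) - y)) = - Re (character l y)"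
      by (simp add: character_def)
  qed (auto intro: order_trans[OF abs_Re_le_cmod])
  moreover have "(LINT y|torus. Im (character l y)) = 0"
    by (rule integral_torus_eq_0[OF _ per(2), where a = 0])
      (auto intro: order_trans[OF abs_Im_le_cmod] simp: character_def)
  ultimately show ?thesis
    using False int by (simp add: complex_eq_iff)
qed simp

section \<open>Fourier series on the torus\<close>

lemma sigma_finite_count_space_UNIV: "sigma_finite_measure (count_space (UNIV :: 'a::countable set))"
  by (simp add: sigma_finite_measure_count_space)

lemma pair_sigma_finite_count_torus:
  "pair_sigma_finite (count_space (UNIV :: 'a::countable set)) (torus :: (real^'n) measure)"
  by (simp add: pair_sigma_finite_def sigma_finite_count_space_UNIV torus.sigma_finite_measure_axioms)

lemma measurable_ztorusI:
  assumes "\<And>k. (\<lambda>y. f (k, y)) \<in> measurable torus N"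
  shows "f \<in> measurable (count_space (UNIV :: 'a::countable set) \<Otimes>\<^sub>M (torus :: (real^'n) measure)) N"
  using assms by (intro measurable_pair_measure_countable1) auto

text \<open>The series is a parameter integral of a jointly measurable function; the Bochner
  integral depends measurably on the parameter, default values included.\<close>

lemma fourier_series_measurable:
  fixes a :: "int^'n \<Rightarrow> complex"
  shows "(\<lambda>x. \<Sum>\<^sub>\<infinity>j. a j * cnj (character j x)) \<in> borel_measurable torus"
proof -
  have "(\<lambda>p. a (fst p) * cnj (character (fst p) (snd p))) \<in>
      borel_measurable (count_space UNIV \<Otimes>\<^sub>M torus)"
    by (rule measurable_ztorusI, unfold fst_conv snd_conv character_cnj) measurable
  from measurable_pair_swap[OF this]
  have "(\<lambda>(x, j). a j * cnj (character j x)) \<in> borel_measurable (torus \<Otimes>\<^sub>M count_space UNIV)"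
    by (simp add: case_prod_beta)
  then show ?thesis
    unfolding infsum_eq_integral_count_space
    by (rule sigma_finite_measure.borel_measurable_lebesgue_integral[OF sigma_finite_count_space_UNIV])
qed

lemma integrable_character: "integrable torus (character l)"
  by (intro torus.integrable_const_bound[of _ 1] AE_I2) auto

text \<open>The coefficient is recovered by integrating the series against
  \<open>character k\<close>. Absolute summability of \<open>a\<close> and the finite measure of the
  torus justify the exchange of sum and integral.\<close>

lemma fourier_coeff_bound:
  fixes a :: "int^'n \<Rightarrow> complex"
  assumes a: "integrable (count_space UNIV) a"
  shows "ennreal (norm (a k)) \<le> (\<integral>\<^sup>+x. ennreal (norm (\<Sum>\<^sub>\<infinity>j. a j * cnj (character j x))) \<partial>torus)"
proof -
  interpret pair_sigma_finite "count_space (UNIV :: (int^'n) set)" "torus :: (real^'n) measure"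
    by (rule pair_sigma_finite_count_torus)
  have int: "integrable (count_space UNIV \<Otimes>\<^sub>M torus) (\<lambda>(j, x). a j * character (k - j) x)"
    using a by (intro Fubini_integrable measurable_ztorusI AE_I2)
      (auto simp: norm_mult intro!: integrable_mult_right integrable_character)
  have "a k = (LINT j|count_space UNIV. a k * indicator {k} j)"
    by (simp add: lebesgue_integral_count_space_finite_support Collect_conv_if indicator_def)
  also have "\<dots> = (LINT j|count_space UNIV. LINT x|torus. a j * character (k - j) x)"
    by (intro Bochner_Integration.integral_cong) (auto simp: integral_character)
  also have "\<dots> = (LINT x|torus. LINT j|count_space UNIV. a j * character (k - j) x)"
    by (rule Fubini_integral[OF int, symmetric])
  also have "\<dots> = (LINT x|torus. (\<Sum>\<^sub>\<infinity>j. a j * cnj (character j x)) * character k x)"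
    unfolding infsum_eq_integral_count_space
    by (intro Bochner_Integration.integral_cong refl, subst integral_mult_left_zero[symmetric])
      (simp_all add: character_cnj character_add[symmetric] mult.assoc)
  finally have *: "a k = (LINT x|torus. (\<Sum>\<^sub>\<infinity>j. a j * cnj (character j x)) * character k x)" .
  have "ennreal (norm (a k)) \<le>
      (\<integral>\<^sup>+x. ennreal (norm ((\<Sum>\<^sub>\<infinity>j. a j * cnj (character j x)) * character k x)) \<partial>torus)"
  proof (cases "integrable torus (\<lambda>x. (\<Sum>\<^sub>\<infinity>j. a j * cnj (character j x)) * character k x)")
    case True
    then show ?thesis unfolding * by (rule integral_norm_bound_ennreal)
  next
    case False
    then show ?thesis unfolding * by (simp add: not_integrable_integral_eq)
  qed
  then show ?thesis by (simp add: norm_mult)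
qed

section \<open>Trigonometric polynomials, their uniform density, and the L^1 bound by Fourier
  coefficients\<close>

inductive trig_poly :: "(real^'n \<Rightarrow> complex) \<Rightarrow> bool" where
  monomial: "trig_poly (\<lambda>y. c * character l y)"
| add: "trig_poly p \<Longrightarrow> trig_poly q \<Longrightarrow> trig_poly (\<lambda>y. p y + q y)"

lemma trig_poly_const: "trig_poly (\<lambda>_. c)"
  using trig_poly.monomial[of c 0] by simp

lemma trig_poly_mult:
  assumes "trig_poly p" "trig_poly q"
  shows "trig_poly (\<lambda>y. p y * q y)"
  using assms(1)
proof induction
  case (monomial c l)
  from assms(2) show ?case
  proof induction
    case (monomial d k)
    have "(\<lambda>y. c * character l y * (d * character k y)) = (\<lambda>y. c * d * character (l + k) y)"
      by (auto simp: character_add)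
    then show ?case by (simp only: trig_poly.monomial)
  next
    case (add p q)
    from trig_poly.add[OF add.IH] show ?case by (simp add: distrib_left)
  qed
next
  case (add p' q')
  from trig_poly.add[OF add.IH] show ?case by (simp add: distrib_right)
qed

lemma trig_poly_sum:
  assumes "finite I" "\<And>i. i \<in> I \<Longrightarrow> trig_poly (p i)"
  shows "trig_poly (\<lambda>y. \<Sum>i\<in>I. p i y)"
  using assms by (induction rule: finite_induct) (auto intro: trig_poly.add trig_poly_const)

text \<open>Terms of equal frequency are collected, so that orthogonality can single out each
  coefficient.\<close>

lemma trig_poly_expansion:
  assumes "trig_poly p"
  obtains S a where "finite S" "p = (\<lambda>y. \<Sum>l\<in>S. a l * character l y)"
  using assms
proof (induction arbitrary: thesis)
  case (monomial c l)
  show ?case by (rule monomial[of "{l}" "\<lambda>_. c"]) auto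
next
  case (add p q)
  obtain S a where S: "finite S" "p = (\<lambda>y. \<Sum>l\<in>S. a l * character l y)" by (rule add.IH(1))
  obtain T b where T: "finite T" "q = (\<lambda>y. \<Sum>l\<in>T. b l * character l y)" by (rule add.IH(2))
  show ?case
  proof (rule add.prems)
    show "finite (S \<union> T)" using S T by simp
    have "p y + q y = (\<Sum>l\<in>S \<union> T. ((if l \<in> S then a l else 0) + (if l \<in> T then b l else 0)) * character l y)" for y
    proof -
      have "p y = (\<Sum>l\<in>S \<union> T. (if l \<in> S then a l else 0) * character l y)"
        using S T by (auto intro!: sum.mono_neutral_cong_left)
      moreover have "q y = (\<Sum>l\<in>S \<union> T. (if l \<in> T then b l else 0) * character l y)"
        using S T by (auto intro!: sum.mono_neutral_cong_left)
      ultimately show ?thesis by (simp add: distrib_right sum.distrib)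
    qed
    then show "(\<lambda>y. p y + q y) = (\<lambda>y. \<Sum>l\<in>S \<union> T. ((if l \<in> S then a l else 0) + (if l \<in> T then b l else 0)) * character l y)"
      by blast
  qed
qed

lemma trig_poly_continuous:
  assumes "trig_poly p" shows "continuous_on A p"
  using assms by induction (auto intro!: continuous_intros)

text \<open>Each coefficient of \<open>p\<close> is the integral of \<open>p\<close> against a
  character and hence at most \<open>C\<close>. Pairing with \<open>h\<close> therefore costs at
  most \<open>C\<close> times a finite sum of Fourier coefficients of \<open>h\<close>.\<close>

lemma trig_poly_pairing_bound:
  fixes h :: "real^'n \<Rightarrow> complex"
  assumes h: "integrable torus h"
    and N: "\<And>S. finite S \<Longrightarrow> (\<Sum>l\<in>S. norm (LINT y|torus. h y * character l y)) \<le> N"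
    and p: "trig_poly p" and C: "\<And>y. y \<in> cbox 0 1 \<Longrightarrow> norm (p y) \<le> C"
  shows "norm (LINT y|torus. h y * p y) \<le> C * N"
proof -
  obtain S a where S: "finite S" and pS: "p = (\<lambda>y. \<Sum>l\<in>S. a l * character l y)"
    using p by (rule trig_poly_expansion)
  have hch: "integrable torus (\<lambda>y. h y * character l y)" for l
    by (rule Bochner_Integration.integrable_bound[OF h]) (use h in \<open>auto simp: norm_mult\<close>)
  have a: "norm (a l) \<le> C" if "l \<in> S" for l
  proof -
    have "(LINT y|torus. p y * character (- l) y) = (LINT y|torus. (\<Sum>k\<in>S. a k * character (k - l) y))"
      unfolding pS by (simp add: sum_distrib_right mult.assoc character_add[symmetric])
    also have "\<dots> = (\<Sum>k\<in>S. a k * of_bool (k = l))"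
      by (subst Bochner_Integration.integral_sum) (auto simp: integral_character integrable_character)
    also have "\<dots> = a l" using S that by (simp add: of_bool_def if_distrib cong: if_cong)
    finally have "norm (a l) = norm (LINT y|torus. p y * character (- l) y)" by simp
    also have "\<dots> \<le> (LINT y|(torus :: (real^'n) measure). C)"
    proof (rule Bochner_Integration.integral_norm_bound_integral)
      have "p \<in> borel_measurable torus"
        by (intro continuous_imp_measurable_torus trig_poly_continuous p)
      then show "integrable torus (\<lambda>y. p y * character (- l) y)"
        using C by (intro torus.integrable_const_bound[of _ C] AE_I2) (auto simp: norm_mult)
    qed (use C in \<open>auto simp: norm_mult\<close>)
    finally show ?thesis by simp
  qed
  have C0: "0 \<le> C" using C[of 0] order_trans[OF norm_ge_zero[of "p 0"], of C] by (auto simp: mem_box_cart)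
  have "(LINT y|torus. h y * p y) = (LINT y|torus. (\<Sum>l\<in>S. a l * (h y * character l y)))"
    unfolding pS by (simp add: sum_distrib_left mult.left_commute)
  also have "\<dots> = (\<Sum>l\<in>S. a l * (LINT y|torus. h y * character l y))"
    by (subst Bochner_Integration.integral_sum) (auto simp: hch)
  also have "norm \<dots> \<le> (\<Sum>l\<in>S. C * norm (LINT y|torus. h y * character l y))"
    by (rule order_trans[OF norm_sum]) (auto intro!: sum_mono mult_right_mono a simp: norm_mult)
  also have "\<dots> \<le> C * N"
    using N[OF S] C0 by (simp add: sum_distrib_left[symmetric] mult_left_mono)
  finally show ?thesis .
qed

text \<open>The torus as a product of unit circles in complex n-space: a compact set on which the
  theorem of Stone and Weierstrass applies, and from which polynomials pull back to trigonometric
  polynomials.\<close>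

definition torus_embed :: "real^'n \<Rightarrow> complex^'n" where
  "torus_embed y = (\<chi> i. cis (2 * pi * (y $ i)))"

lemma continuous_torus_embed: "continuous_on A torus_embed"
  unfolding torus_embed_def by (intro continuous_intros)

text \<open>Points of the closed cube are identified only along its faces: the integer by which
  coordinates may differ lies strictly between -1 and 1 as soon as one point is interior.\<close>

lemma torus_embed_eq_interior:
  assumes y: "y \<in> box 0 1" and z: "z \<in> cbox 0 1" and eq: "torus_embed y = torus_embed z"
  shows "y = z"
proof -
  have "y $ i = z $ i" for i
  proof -
    have "cis (2 * pi * (y $ i)) = cis (2 * pi * (z $ i))"
      using eq by (simp add: torus_embed_def vec_eq_iff)
    then obtain n :: int where n: "2 * pi * (y $ i) = 2 * pi * (z $ i) + 2 * pi * n"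
      using sin_cos_eq_iff by (auto simp: complex_eq_iff)
    then have "2 * pi * (y $ i - z $ i - n) = 0" by (simp add: algebra_simps)
    then have n': "y $ i = z $ i + n" by simp
    have "0 < y $ i" "y $ i < 1" "0 \<le> z $ i" "z $ i \<le> 1"
      using y z by (auto simp: mem_box_cart)
    with n' have "n = 0" by linarith
    with n' show ?thesis by simp
  qed
  then show ?thesis by (simp add: vec_eq_iff)
qed

text \<open>The real coordinates of \<open>torus_embed y\<close> are cosines and sines, that is,
  combinations of the characters with frequencies \<open>axis i 1\<close> and
  \<open>- axis i 1\<close>. Products and sums are then covered by the closure properties of
  \<open>trig_poly\<close>.\<close>

lemma trig_poly_of_polynomial:
  fixes f :: "complex^'n \<Rightarrow> real"
  assumes "real_polynomial_function f"
  shows "trig_poly (\<lambda>y. of_real (f (torus_embed y)))"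
  using assms
proof induction
  case (linear f)
  have comp: "trig_poly (\<lambda>y. of_real (torus_embed y \<bullet> b))" if "b \<in> Basis" for b :: "complex^'n"
  proof -
    obtain i u where b: "b = axis i u" "u \<in> {1, \<i>}"
      using \<open>b \<in> Basis\<close> by (auto simp: Basis_vec_def Basis_complex_def)
    have *: "cis (2 * pi * (y $ i)) = character (axis i 1) y" for y :: "real^'n"
    proof -
      have "rvec (axis i 1) = axis i 1" by (auto simp: rvec_def axis_def vec_eq_iff)
      then show ?thesis by (simp add: character_def inner_axis)
    qed
    have "(\<lambda>y. complex_of_real (Re (character (axis i 1) y))) =
        (\<lambda>y. 1/2 * character (axis i 1) y + 1/2 * character (- axis i 1) y)"
      "(\<lambda>y. complex_of_real (Im (character (axis i 1) y))) =
        (\<lambda>y. - \<i>/2 * character (axis i 1) y + \<i>/2 * character (- axis i 1) y)"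
      by (simp_all add: fun_eq_iff complex_eq_iff flip: character_cnj)
    then have "trig_poly (\<lambda>y. of_real (Re (character (axis i 1) y)))"
      "trig_poly (\<lambda>y. of_real (Im (character (axis i 1) y)))"
      by (simp_all only: trig_poly.intros)
    moreover have "torus_embed y \<bullet> b = (if u = 1 then Re (character (axis i 1) y) else Im (character (axis i 1) y))" for y
      using b by (auto simp: torus_embed_def inner_axis inner_complex_def *)
    ultimately show ?thesis by (cases "u = 1") simp_all
  qed
  have expansion: "f x = (\<Sum>b\<in>Basis. f b * (x \<bullet> b))" for x
  proof -
    note lin = bounded_linear.linear[OF linear]
    have "f x = f (\<Sum>b\<in>Basis. (x \<bullet> b) *\<^sub>R b)" by (simp add: euclidean_representation)
    also have "\<dots> = (\<Sum>b\<in>Basis. f ((x \<bullet> b) *\<^sub>R b))" by (rule linear_sum[OF lin])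
    also have "\<dots> = (\<Sum>b\<in>Basis. f b * (x \<bullet> b))"
      by (simp only: linear_cmul[OF lin] real_scaleR_def mult.commute)
    finally show ?thesis .
  qed
  have "(\<lambda>y. complex_of_real (f (torus_embed y))) =
      (\<lambda>y. \<Sum>b\<in>Basis. of_real (f b) * of_real (torus_embed y \<bullet> b))"
  proof
    fix y
    show "complex_of_real (f (torus_embed y)) =
        (\<Sum>b\<in>Basis. of_real (f b) * of_real (torus_embed y \<bullet> b))"
      unfolding expansion[of "torus_embed y"] by simp
  qed
  moreover have "trig_poly (\<lambda>y. \<Sum>b\<in>Basis. of_real (f b) * of_real (torus_embed y \<bullet> b))"
    by (intro trig_poly_sum trig_poly_mult trig_poly_const comp) auto
  ultimately show ?case by simp
qed (auto intro!: trig_poly.add trig_poly_mult trig_poly_const)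

text \<open>Vanishing on the boundary makes \<open>u\<close> compatible with the identification of
  opposite faces, so it descends to the image of \<open>torus_embed\<close>. For integrals this
  restriction is harmless since the boundary is a null set.\<close>

lemma trig_poly_dense:
  fixes u :: "real^'n \<Rightarrow> complex"
  assumes u: "continuous_on (cbox 0 1) u" and bd: "\<And>y. y \<in> cbox 0 1 - box 0 1 \<Longrightarrow> u y = 0"
    and e: "0 < e"
  obtains p where "trig_poly p" "\<And>y. y \<in> cbox 0 1 \<Longrightarrow> norm (u y - p y) < e"
proof -
  let ?Q = "cbox 0 1 :: (real^'n) set"
  \<comment> \<open>The preimage chosen by \<open>inv_into\<close> does not matter: two different
    preimages of a point both lie on the boundary, where \<open>u\<close> is 0.\<close>
  define v where "v z = u (inv_into ?Q torus_embed z)" for z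
  have v: "v (torus_embed y) = u y" if y: "y \<in> ?Q" for y
  proof -
    define x where "x = inv_into ?Q torus_embed (torus_embed y)"
    have x: "x \<in> ?Q" "torus_embed x = torus_embed y"
      unfolding x_def using y by (auto intro: inv_into_into f_inv_into_f)
    have "u x = u y"
    proof (cases "x \<in> box 0 1 \<or> y \<in> box 0 1")
      case True
      then show ?thesis using torus_embed_eq_interior x y by metis
    next
      case False
      then show ?thesis using bd[of x] bd[of y] x y by auto
    qed
    then show ?thesis by (simp add: v_def x_def)
  qed
  have K: "compact (torus_embed ` ?Q)"
    by (intro compact_continuous_image continuous_torus_embed compact_cbox)
  \<comment> \<open>A continuous map on a compact set is closed, so \<open>torus_embed\<close> is a
    quotient map onto its image: the preimage of a closed set under \<open>v\<close> is the image of
    a compact set.\<close>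
  have "continuous_on (torus_embed ` ?Q) v"
  proof (subst continuous_on_closed_vimage[OF compact_imp_closed[OF K]], intro allI impI)
    fix B :: "complex set" assume "closed B"
    have "closed (u -` B \<inter> ?Q)"
      using continuous_on_closed_vimage[of ?Q u] u \<open>closed B\<close> by auto
    then have "compact (?Q \<inter> (u -` B \<inter> ?Q))" by (intro compact_Int_closed compact_cbox)
    then have "compact (torus_embed ` (?Q \<inter> (u -` B \<inter> ?Q)))"
      by (intro compact_continuous_image continuous_torus_embed)
    moreover have "v -` B \<inter> torus_embed ` ?Q = torus_embed ` (?Q \<inter> (u -` B \<inter> ?Q))"
      using v by (auto simp: image_iff)
    ultimately show "closed (v -` B \<inter> torus_embed ` ?Q)" by (simp add: compact_imp_closed)
  qed
  from Stone_Weierstrass_polynomial_function[OF K this e] obtain g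
    where g: "polynomial_function g" "\<And>z. z \<in> torus_embed ` ?Q \<Longrightarrow> norm (v z - g z) < e" by blast
  have "real_polynomial_function (\<lambda>z. Re (g z))" "real_polynomial_function (\<lambda>z. Im (g z))"
    using g(1) bounded_linear_Re bounded_linear_Im unfolding polynomial_function_def o_def by auto
  then have "trig_poly (\<lambda>y. of_real (Re (g (torus_embed y))) + \<i> * of_real (Im (g (torus_embed y))))"
    by (intro trig_poly.add trig_poly_mult trig_poly_const) (auto dest: trig_poly_of_polynomial)
  then have "trig_poly (\<lambda>y. g (torus_embed y))" by (simp flip: complex_eq)
  then show ?thesis
  proof (rule that)
    show "norm (u y - g (torus_embed y)) < e" if "y \<in> ?Q" for y
      using g(2)[of "torus_embed y"] v[of y] that by simp
  qed
qed

text \<open>The L^1 norm is the pairing of \<open>h\<close> with the conjugate of its sign. This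
  sign function is an almost everywhere limit of continuous functions of norm at most 1 that vanish
  on the boundary; for those, \<open>trig_poly_dense\<close> and
  \<open>trig_poly_pairing_bound\<close> give the bound \<open>N\<close>.\<close>

lemma fourier_L1_bound:
  fixes h :: "real^'n \<Rightarrow> complex"
  assumes h: "integrable torus h"
    and N: "\<And>S. finite S \<Longrightarrow> (\<Sum>l\<in>S. norm (LINT y|torus. h y * character l y)) \<le> N"
  shows "(LINT y|torus. norm (h y)) \<le> N"
proof -
  let ?Q = "cbox 0 1 :: (real^'n) set"
  define v where "v y = indicator ?Q y *\<^sub>R cnj (sgn (h y))" for y
  have [measurable]: "h \<in> borel_measurable torus" using h by simp
  have "(\<lambda>y. cnj (sgn (h y))) \<in> borel_measurable torus"
    by (rule measurable_compose[OF _ borel_measurable_continuous_onI[of cnj]]) (auto intro!: continuous_intros simp: sgn_div_norm)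
  then have "v \<in> borel_measurable lborel"
    unfolding v_def torus_def by (subst (asm) borel_measurable_restrict_space_iff) auto
  \<comment> \<open>\<open>measurable_on\<close> means pointwise approximability by continuous
    functions off a negligible set, which is the source of \<open>g\<close>.\<close>
  then have "v measurable_on UNIV"
    by (intro lebesgue_measurable_imp_measurable_on) (auto intro: measurable_completion)
  then obtain Z g where Z: "negligible Z" and g: "\<And>n. continuous_on UNIV (g n)"
    and lim: "\<And>y. y \<notin> Z \<Longrightarrow> (\<lambda>n. g n y) \<longlonglongrightarrow> v y"
    unfolding measurable_on_def by auto
  have AE: "AE y in torus. y \<notin> Z \<and> y \<in> box 0 1"
  proof -
    have "AE y in lborel. y \<notin> Z"
      using Z AE_completion_iff[of "\<lambda>y. y \<notin> Z" "lborel :: (real^'n) measure"]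
      by (auto simp: negligible_iff_null_sets intro: AE_not_in)
    with AE_lborel_not_boundary have "AE y in lborel. y \<in> ?Q \<longrightarrow> y \<notin> Z \<and> y \<in> box 0 1"
      by eventually_elim auto
    then show ?thesis
      unfolding torus_def by (subst AE_restrict_space_iff) auto
  qed
  \<comment> \<open>The cutoff vanishes outside the open cube and is eventually 1 at each interior
    point. Division by \<open>max 1 (norm (g n y))\<close> then truncates to norm at most 1 without
    moving the limit, because \<open>v\<close> itself has norm at most 1.\<close>
  define \<phi> where "\<phi> n y = min 1 (real n * infdist y (- box 0 1))" for n and y :: "real^'n"
  define u where "u n y = \<phi> n y *\<^sub>R (g n y /\<^sub>R max 1 (norm (g n y)))" for n y
  have ne: "- box 0 1 \<noteq> ({} :: (real^'n) set)" by (metis ComplI empty_iff box_real(1) interval_cbox mem_box_cart(1) zero_index less_irrefl)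
  have cl: "closed (- box 0 1 :: (real^'n) set)" by (simp add: closed_Compl open_box)
  have \<phi>: "0 \<le> \<phi> n y" "\<phi> n y \<le> 1" for n y by (auto simp: \<phi>_def infdist_nonneg)
  have u_cont: "continuous_on UNIV (u n)" for n
    unfolding u_def \<phi>_def using g[of n] by (intro continuous_intros) (auto simp: max_def)
  have u_bdry: "u n y = 0" if "y \<in> ?Q - box 0 1" for n y
    using that by (simp add: u_def \<phi>_def)
  have u_norm: "norm (u n y) \<le> 1" for n y
  proof -
    have "norm (g n y /\<^sub>R max 1 (norm (g n y))) \<le> 1" by (simp add: divide_simps)
    with \<phi>[of n y] have "\<phi> n y * norm (g n y /\<^sub>R max 1 (norm (g n y))) \<le> 1"
      by (intro mult_le_one) auto
    then show ?thesis unfolding u_def norm_scaleR using \<phi>[of n y] by simp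
  qed
  have [measurable]: "u n \<in> borel_measurable torus" for n
    by (rule continuous_imp_measurable_torus[OF u_cont])
  have hu: "integrable torus (\<lambda>y. h y * w y)"
    if "w \<in> borel_measurable torus" "\<And>y. y \<in> ?Q \<Longrightarrow> norm (w y) \<le> C" for w and C :: real
  proof (rule Bochner_Integration.integrable_bound[of _ "\<lambda>y. C * norm (h y)"])
    show "AE y in torus. norm (h y * w y) \<le> norm (C * norm (h y))"
    proof (rule AE_I2)
      fix y :: "real^'n" assume "y \<in> space torus"
      then have "norm (h y) * norm (w y) \<le> norm (h y) * \<bar>C\<bar>"
        using that(2)[of y] by (intro mult_left_mono) auto
      then show "norm (h y * w y) \<le> norm (C * norm (h y))"
        by (simp add: norm_mult abs_mult mult.commute)
    qed
  qed (use h that in auto)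
  have bound: "norm (LINT y|torus. h y * u n y) \<le> N" for n
  proof (rule field_le_epsilon)
    fix e :: real assume "e > 0"
    let ?H = "LINT y|torus. norm (h y)"
    have H: "0 \<le> ?H" by simp
    have "0 \<le> N" using N[of "{}"] by simp
    \<comment> \<open>An approximation within \<open>d\<close> changes the bound by at most d(N +
      H), where H is the L^1 norm of \<open>h\<close>; the summand 1 keeps the denominator
      positive.\<close>
    define d where "d = e / (N + ?H + 1)"
    have d: "0 < d" using \<open>e > 0\<close> H \<open>0 \<le> N\<close> by (simp add: d_def add_nonneg_pos)
    obtain p where p: "trig_poly p" "\<And>y. y \<in> ?Q \<Longrightarrow> norm (u n y - p y) < d"
      by (rule trig_poly_dense[OF continuous_on_subset[OF u_cont] u_bdry d]) auto
    have p_norm: "norm (p y) \<le> 1 + d" if "y \<in> ?Q" for y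
      using norm_triangle_sub[of "p y" "u n y"] u_norm[of n y] p(2)[OF that] by (simp add: norm_minus_commute)
    have [measurable]: "p \<in> borel_measurable torus"
      by (intro continuous_imp_measurable_torus trig_poly_continuous p)
    have "(LINT y|torus. h y * u n y) = (LINT y|torus. h y * p y) + (LINT y|torus. h y * (u n y - p y))"
      using hu[of "u n" 1] hu[of p "1 + d"] u_norm p_norm by (simp add: right_diff_distrib)
    then have "norm (LINT y|torus. h y * u n y)
        \<le> norm (LINT y|torus. h y * p y) + norm (LINT y|torus. h y * (u n y - p y))"
      by (simp add: norm_triangle_ineq)
    also have "norm (LINT y|torus. h y * p y) \<le> (1 + d) * N"
      by (rule trig_poly_pairing_bound[OF h N p(1) p_norm])
    also have "norm (LINT y|torus. h y * (u n y - p y)) \<le> (LINT y|torus. d * norm (h y))"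
    proof (rule Bochner_Integration.integral_norm_bound_integral)
      show "integrable torus (\<lambda>y. h y * (u n y - p y))"
        using p(2) by (intro hu[of _ d]) (auto intro: less_imp_le)
      show "norm (h y * (u n y - p y)) \<le> d * norm (h y)" if "y \<in> space torus" for y
        using p(2)[of y] that mult_left_mono[of "norm (u n y - p y)" d "norm (h y)"]
        by (simp add: norm_mult mult.commute)
    qed (use h in simp)
    also have "(1 + d) * N + (LINT y|torus. d * norm (h y)) = N + d * (N + ?H)"
      by (simp add: algebra_simps)
    also have "\<dots> \<le> N + d * (N + ?H + 1)" using d by simp
    also have "\<dots> = N + e"
    proof -
      have "0 < N + ?H + 1" using H \<open>0 \<le> N\<close> by linarith
      then show ?thesis by (simp add: d_def)
    qed
    finally show "norm (LINT y|torus. h y * u n y) \<le> N + e" by simp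
  qed
  have "(\<lambda>n. LINT y|torus. h y * u n y) \<longlonglongrightarrow> (LINT y|torus. of_real (norm (h y)))"
  proof (rule integral_dominated_convergence[where w = "\<lambda>y. norm (h y)"])
    show "AE y in torus. (\<lambda>n. h y * u n y) \<longlonglongrightarrow> of_real (norm (h y))"
      using AE
    proof eventually_elim
      fix y assume y: "y \<notin> Z \<and> y \<in> box 0 1"
      then have "infdist y (- box 0 1) > 0"
        using in_closed_iff_infdist_zero[OF cl ne, of y] infdist_nonneg[of y "- box 0 1"] by auto
      then have "eventually (\<lambda>n. \<phi> n y = 1) sequentially"
        using eventually_ge_at_top[of "nat \<lceil>1 / infdist y (- box 0 1)\<rceil>"]
        by (auto elim!: eventually_mono simp: \<phi>_def field_simps nat_le_iff ceiling_le_iff)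
      then have 1: "(\<lambda>n. \<phi> n y) \<longlonglongrightarrow> 1" by (rule tendsto_eventually)
      have vy: "v y = cnj (sgn (h y))" "norm (v y) \<le> 1"
        using y box_subset_cbox[of 0 1] by (auto simp: v_def norm_sgn)
      have "(\<lambda>n. u n y) \<longlonglongrightarrow> 1 *\<^sub>R (v y /\<^sub>R max 1 (norm (v y)))"
        unfolding u_def using lim[of y] y by (intro tendsto_intros 1) auto
      moreover have "max 1 (norm (v y)) = 1" using vy(2) by simp
      ultimately have "(\<lambda>n. u n y) \<longlonglongrightarrow> cnj (sgn (h y))"
        by (simp only: vy(1)) simp
      then have "(\<lambda>n. h y * u n y) \<longlonglongrightarrow> h y * cnj (sgn (h y))"
        by (intro tendsto_intros)
      moreover have "h y * cnj (sgn (h y)) = of_real (norm (h y))"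
      proof (cases "h y = 0")
        case False
        have "h y * cnj (sgn (h y)) = h y * cnj (h y) / of_real (norm (h y))"
          by (simp add: sgn_div_norm scaleR_conv_of_real field_simps)
        also have "\<dots> = of_real (norm (h y))"
          using False by (simp add: complex_norm_square[symmetric] power2_eq_square)
        finally show ?thesis .
      qed simp
      ultimately show "(\<lambda>n. h y * u n y) \<longlonglongrightarrow> of_real (norm (h y))" by simp
    qed
    show "AE y in torus. norm (h y * u n y) \<le> norm (h y)" for n
      using u_norm by (intro AE_I2) (simp add: norm_mult mult_left_le)
  qed (use h in auto)
  then have "norm (LINT y|torus. complex_of_real (norm (h y))) \<le> N"
    using bound by (intro tendsto_upperbound[OF tendsto_norm]) (auto intro: always_eventually)
  then show ?thesis by simp
qed

lemma fourier_L1_bound_nn: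
  fixes h :: "real^'n \<Rightarrow> complex"
  assumes h: "integrable torus h"
  shows "(\<integral>\<^sup>+y. ennreal (norm (h y)) \<partial>torus) \<le>
    (\<integral>\<^sup>+l. ennreal (norm (LINT y|torus. h y * character l y)) \<partial>count_space UNIV)"
proof (cases "(\<integral>\<^sup>+l. ennreal (norm (LINT y|torus. h y * character l y)) \<partial>count_space UNIV)")
  case (real N)
  have "(LINT y|torus. norm (h y)) \<le> N"
  proof (rule fourier_L1_bound[OF h])
    fix S :: "(int^'n) set" assume S: "finite S"
    have "ennreal (\<Sum>l\<in>S. norm (LINT y|torus. h y * character l y)) =
        (\<integral>\<^sup>+l. ennreal (norm (LINT y|torus. h y * character l y)) \<partial>count_space S)"
      using S by (simp add: nn_integral_count_space_finite sum_ennreal)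
    also have "\<dots> \<le> ennreal N"
      unfolding real(2)[symmetric]
      by (subst nn_integral_count_space_indicator) (auto intro!: nn_integral_mono simp: indicator_def)
    finally show "(\<Sum>l\<in>S. norm (LINT y|torus. h y * character l y)) \<le> N"
      using real(1) by (simp add: ennreal_le_iff)
  qed
  then show ?thesis
    unfolding real(2) using h by (subst nn_integral_eq_integral) (auto intro: ennreal_leI)
qed simp

section \<open>Modulation norms and sequence norms\<close>

lemma schwartz_Z_nonneg_const:
  fixes g :: "int^'n \<Rightarrow> complex"
  assumes "\<forall>k. norm (g k) \<le> C / (1 + norm (rvec k)) ^ M"
  shows "0 \<le> C"
  using order_trans[OF norm_ge_zero assms[rule_format, of 0]] by simp

text \<open>The weight is submultiplicative, 1 + |k| <= (1 + |m|)(1 + |k - m|), so a translation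
  costs only the factor (1 + |m|)^M.\<close>

lemma translation_schwartz_Z:
  assumes "g \<in> schwartz_Z"
  shows "translation m g \<in> schwartz_Z"
  unfolding schwartz_Z_def
proof (intro CollectI allI)
  fix M :: nat
  obtain C where C: "\<forall>k. norm (g k) \<le> C / (1 + norm (rvec k)) ^ M"
    using assms unfolding schwartz_Z_def by blast
  have "0 \<le> C" by (rule schwartz_Z_nonneg_const[OF C])
  show "\<exists>C. \<forall>k. norm (translation m g k) \<le> C / (1 + norm (rvec k)) ^ M"
  proof (intro exI allI)
    fix k
    have "1 + norm (rvec k) \<le> 1 + norm (rvec (k - m)) + norm (rvec m)"
      using norm_triangle_ineq[of "rvec (k - m)" "rvec m"] by simp
    also have "\<dots> \<le> (1 + norm (rvec m)) * (1 + norm (rvec (k - m)))"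
      by (simp add: algebra_simps)
    finally have "(1 + norm (rvec k)) ^ M \<le> ((1 + norm (rvec m)) * (1 + norm (rvec (k - m)))) ^ M"
      by (rule power_mono) simp
    then have le: "(1 + norm (rvec k)) ^ M \<le> (1 + norm (rvec m)) ^ M * (1 + norm (rvec (k - m))) ^ M"
      by (simp only: power_mult_distrib)
    have pos: "0 < (1 + norm (rvec k)) ^ M" "0 < (1 + norm (rvec (k - m))) ^ M"
      by (simp_all add: add_pos_nonneg del: rvec_simps)
    have "norm (translation m g k) \<le> C / (1 + norm (rvec (k - m))) ^ M"
      using C by (simp add: translation_def del: rvec_simps)
    also have "\<dots> \<le> C * (1 + norm (rvec m)) ^ M / (1 + norm (rvec k)) ^ M"
      using mult_left_mono[OF le \<open>0 \<le> C\<close>] pos by (simp add: field_simps del: rvec_simps)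
    finally show "norm (translation m g k) \<le> C * (1 + norm (rvec m)) ^ M / (1 + norm (rvec k)) ^ M" .
  qed
qed

lemma cnj_schwartz_Z: "g \<in> schwartz_Z \<Longrightarrow> (\<lambda>k. cnj (g k)) \<in> schwartz_Z"
  by (simp add: schwartz_Z_def)

lemma abs_summable_inverse_squares_int:
  "Infinite_Set_Sum.abs_summable_on (\<lambda>t::int. 1 / (1 + \<bar>real_of_int t\<bar>)\<^sup>2) UNIV"
proof -
  have s: "Infinite_Set_Sum.abs_summable_on (\<lambda>n::nat. 1 / (1 + real n)\<^sup>2) UNIV"
  proof (subst Infinite_Set_Sum.abs_summable_on_nat_iff')
    have "summable (\<lambda>n. inverse (real (Suc n) ^ 2))"
      using inverse_power_summable[of 2, where 'a = real] by (subst summable_Suc_iff) auto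
    then show "summable (\<lambda>n. norm (1 / (1 + real n)\<^sup>2))"
      by (simp add: inverse_eq_divide)
  qed
  have "Infinite_Set_Sum.abs_summable_on (\<lambda>t::int. 1 / (1 + \<bar>real_of_int t\<bar>)\<^sup>2) (range int)"
    using s by (subst Infinite_Set_Sum.abs_summable_on_reindex_iff[symmetric]) (auto simp: inj_on_def)
  moreover have "Infinite_Set_Sum.abs_summable_on (\<lambda>t::int. 1 / (1 + \<bar>real_of_int t\<bar>)\<^sup>2) (range (\<lambda>n. - int n))"
    using s by (subst Infinite_Set_Sum.abs_summable_on_reindex_iff[symmetric]) (auto simp: inj_on_def)
  moreover have "range int \<union> range (\<lambda>n. - int n) = UNIV"
  proof (intro equalityI subsetI UNIV_I)
    show "t \<in> range int \<union> range (\<lambda>n. - int n)" for t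
      by (cases t rule: int_cases2) auto
  qed
  ultimately show ?thesis
    by (metis Infinite_Set_Sum.abs_summable_on_union)
qed

text \<open>Each coordinate is at most the norm, so exponent 2 per dimension makes the weight
  smaller than a product of one-dimensional inverse squares, whose sum factorizes.\<close>

lemma rvec_weight_integrable:
  "integrable (count_space UNIV) (\<lambda>k::int^'n. 1 / (1 + norm (rvec k)) ^ (2 * CARD('n)))"
proof -
  let ?w = "\<lambda>t::int. 1 / (1 + \<bar>real_of_int t\<bar>)\<^sup>2"
  have bij: "bij_betw (\<lambda>(k::int^'n) i. k $ i) UNIV (PiE UNIV (\<lambda>_. UNIV))"
    by (rule bij_betwI[where g = "\<lambda>f. \<chi> i. f i"]) (auto simp: PiE_def)
  have "Infinite_Set_Sum.abs_summable_on (\<lambda>f. \<Prod>i\<in>(UNIV :: 'n set). ?w (f i)) (PiE UNIV (\<lambda>_. UNIV))"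
    by (intro Infinite_Set_Sum.abs_summable_on_prod_PiE abs_summable_inverse_squares_int) auto
  then have "Infinite_Set_Sum.abs_summable_on (\<lambda>k::int^'n. \<Prod>i\<in>UNIV. ?w (k $ i)) UNIV"
    by (subst (asm) Infinite_Set_Sum.abs_summable_on_reindex_bij_betw[OF bij, symmetric])
  then have "integrable (count_space UNIV) (\<lambda>k::int^'n. \<Prod>i\<in>UNIV. ?w (k $ i))"
    by (simp add: Infinite_Set_Sum.abs_summable_on_def)
  then show ?thesis
  proof (rule Bochner_Integration.integrable_bound)
    show "AE k::int^'n in count_space UNIV.
        norm (1 / (1 + norm (rvec k)) ^ (2 * CARD('n))) \<le> norm (\<Prod>i\<in>UNIV. ?w (k $ i))"
    proof (rule AE_I2)
      fix k :: "int^'n"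
      have "(\<Prod>i\<in>UNIV. (1 + \<bar>real_of_int (k $ i)\<bar>)\<^sup>2) \<le> (\<Prod>i\<in>(UNIV :: 'n set). (1 + norm (rvec k))\<^sup>2)"
      proof (intro prod_mono conjI power_mono)
        fix i :: 'n
        show "1 + \<bar>real_of_int (k $ i)\<bar> \<le> 1 + norm (rvec k)"
          using component_le_norm_cart[of "rvec k" i] by (simp add: rvec_def)
      qed auto
      also have "\<dots> = (1 + norm (rvec k)) ^ (2 * CARD('n))"
        by (simp add: power_mult)
      finally have le: "(\<Prod>i\<in>UNIV. (1 + \<bar>real_of_int (k $ i)\<bar>)\<^sup>2) \<le> (1 + norm (rvec k)) ^ (2 * CARD('n))" .
      have pos: "0 < (\<Prod>i\<in>UNIV. (1 + \<bar>real_of_int (k $ i)\<bar>)\<^sup>2)"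
        by (intro prod_pos) (auto simp: add_pos_nonneg)
      have "(\<Prod>i\<in>UNIV. ?w (k $ i)) = 1 / (\<Prod>i\<in>UNIV. (1 + \<bar>real_of_int (k $ i)\<bar>)\<^sup>2)"
        by (simp add: prod_dividef)
      then show "norm (1 / (1 + norm (rvec k)) ^ (2 * CARD('n))) \<le> norm (\<Prod>i\<in>UNIV. ?w (k $ i))"
        using le pos by (simp add: frac_le less_imp_le)
    qed
  qed simp
qed

lemma schwartz_Z_integrable:
  fixes g :: "int^'n \<Rightarrow> complex"
  assumes "g \<in> schwartz_Z"
  shows "integrable (count_space UNIV) g"
proof -
  obtain C where C: "\<forall>k::int^'n. norm (g k) \<le> C / (1 + norm (rvec k)) ^ (2 * CARD('n))"
    using assms unfolding schwartz_Z_def by blast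
  have "0 \<le> C" by (rule schwartz_Z_nonneg_const[OF C])
  show ?thesis
  proof (rule Bochner_Integration.integrable_bound)
    show "integrable (count_space UNIV) (\<lambda>k::int^'n. C * (1 / (1 + norm (rvec k)) ^ (2 * CARD('n))))"
      by (intro integrable_mult_right rvec_weight_integrable)
    show "AE k in count_space UNIV. norm (g k) \<le> norm (C * (1 / (1 + norm (rvec k)) ^ (2 * CARD('n))))"
      using C \<open>0 \<le> C\<close> by (intro AE_I2) auto
  qed simp
qed

lemma schwartz_Z_nn_integral_finite:
  assumes "g \<in> schwartz_Z"
  shows "(\<integral>\<^sup>+k. ennreal (norm (g k)) \<partial>count_space UNIV) < \<infinity>"
  using schwartz_Z_integrable[OF assms] by (simp add: integrable_iff_bounded)

text \<open>The seminorm of order \<open>2 * CARD('n)\<close> pays for the summable weight of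
  \<open>rvec_weight_integrable\<close>. This is how the values of the localization operator are
  recognized as tempered.\<close>

lemma bounded_in_dual_schwartz_Z:
  fixes f :: "int^'n \<Rightarrow> complex"
  assumes D: "\<And>k. norm (f k) \<le> D"
  shows "f \<in> dual_schwartz_Z"
proof -
  let ?J = "2 * CARD('n)"
  let ?W = "LINT k|count_space UNIV. 1 / (1 + norm (rvec k :: real^'n)) ^ ?J"
  have "0 \<le> D" using D[of 0] norm_ge_zero order_trans by blast
  have int: "integrable (count_space UNIV) (\<lambda>k. f k * g k)" if "g \<in> schwartz_Z" for g
  proof (rule Bochner_Integration.integrable_bound)
    show "integrable (count_space UNIV) (\<lambda>k. of_real D * g k)"
      by (intro integrable_mult_right schwartz_Z_integrable that)
    show "AE k in count_space UNIV. norm (f k * g k) \<le> norm (of_real D * g k)"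
      using D \<open>0 \<le> D\<close> by (intro AE_I2) (auto simp: norm_mult intro: mult_right_mono)
  qed simp
  have "norm (\<Sum>\<^sub>\<infinity>k. f k * g k) \<le> (D * ?W) * seminorm_Z ?J g" if g: "g \<in> schwartz_Z" for g
  proof -
    obtain C where C: "\<forall>k::int^'n. norm (g k) \<le> C / (1 + norm (rvec k)) ^ ?J"
      using g unfolding schwartz_Z_def by blast
    have pos: "0 < (1 + norm (rvec k)) ^ ?J" for k :: "int^'n"
      by (simp add: add_pos_nonneg)
    \<comment> \<open>A real supremum bounds its family only if the family is bounded above, which
      the decay of \<open>g\<close> ensures.\<close>
    have "bdd_above (range (\<lambda>k. (1 + norm (rvec k)) ^ ?J * norm (g k)))"
      using C pos by (intro bdd_aboveI[of _ C]) (auto simp: field_simps)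
    then have sn: "(1 + norm (rvec k)) ^ ?J * norm (g k) \<le> seminorm_Z ?J g" for k
      unfolding seminorm_Z_def by (rule cSUP_upper[OF UNIV_I])
    have "norm (\<Sum>\<^sub>\<infinity>k. f k * g k) \<le> (LINT k|count_space UNIV. norm (f k * g k))"
      unfolding infsum_eq_integral_count_space by (rule integral_norm_bound)
    also have "\<dots> \<le> (LINT k|count_space UNIV. D * seminorm_Z ?J g * (1 / (1 + norm (rvec k :: real^'n)) ^ ?J))"
    proof (rule integral_mono)
      show "integrable (count_space UNIV) (\<lambda>k. norm (f k * g k))" using int[OF g] by simp
      show "integrable (count_space UNIV) (\<lambda>k::int^'n. D * seminorm_Z ?J g * (1 / (1 + norm (rvec k)) ^ ?J))"
        by (intro integrable_mult_right rvec_weight_integrable)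
      fix k :: "int^'n"
      have "norm (g k) \<le> seminorm_Z ?J g * (1 / (1 + norm (rvec k)) ^ ?J)"
        using sn[of k] pos[of k] by (simp add: field_simps)
      then have "norm (f k) * norm (g k) \<le> D * (seminorm_Z ?J g * (1 / (1 + norm (rvec k)) ^ ?J))"
        using D \<open>0 \<le> D\<close> by (intro mult_mono) auto
      then show "norm (f k * g k) \<le> D * seminorm_Z ?J g * (1 / (1 + norm (rvec k)) ^ ?J)"
        by (simp add: norm_mult)
    qed
    also have "\<dots> = D * seminorm_Z ?J g * ?W" by (rule integral_mult_right_zero)
    also have "\<dots> = (D * ?W) * seminorm_Z ?J g" by (simp only: mult_ac)
    finally show ?thesis .
  qed
  then show ?thesis
    unfolding dual_schwartz_Z_def summable_on_iff_integrable_count_space using int by blast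
qed

lemma dual_schwartz_Z_integrable:
  assumes "f \<in> dual_schwartz_Z" "g \<in> schwartz_Z"
  shows "integrable (count_space UNIV) (\<lambda>k. f k * cnj (g (k - m)))"
proof -
  have "(\<lambda>k. cnj (translation m g k)) \<in> schwartz_Z"
    by (intro cnj_schwartz_Z translation_schwartz_Z assms)
  moreover have "\<forall>g\<in>schwartz_Z. (\<lambda>k. f k * g k) summable_on UNIV"
    using assms(1) by (simp add: dual_schwartz_Z_def)
  ultimately have "(\<lambda>k. f k * cnj (translation m g k)) summable_on UNIV"
    by (rule bspec[rotated])
  then show ?thesis
    by (simp add: summable_on_iff_integrable_count_space translation_def)
qed

section \<open>The short-time Fourier transform as a Fourier series in \<open>w\<close>\<close>

lemma stft_summand:
  "f k * cnj (modulation w (translation m g) k) = f k * cnj (g (k - m)) * cnj (character k w)"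
  by (simp add: modulation_def translation_def exp_eq_character)

lemma stft_eq_fourier_series:
  "stft g f m w = (\<Sum>\<^sub>\<infinity>k. f k * cnj (g (k - m)) * cnj (character k w))"
  by (simp only: stft_def stft_summand)

lemma stft_measurable [measurable]: "stft g f m \<in> borel_measurable torus"
  using fourier_series_measurable[of "\<lambda>k. f k * cnj (g (k - m))"]
  by (simp add: stft_eq_fourier_series[abs_def])

lemma norm_stft_le:
  "ennreal (norm (stft g f m w)) \<le> (\<integral>\<^sup>+k. ennreal (norm (g (k - m))) * ennreal (norm (f k)) \<partial>count_space UNIV)"
proof -
  have "ennreal (norm (stft g f m w)) \<le> (\<integral>\<^sup>+k. ennreal (norm (f k * cnj (g (k - m)) * cnj (character k w))) \<partial>count_space UNIV)"
    unfolding stft_eq_fourier_series by (rule norm_infsum_le_nn_integral)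
  then show ?thesis by (simp add: norm_mult ennreal_mult mult.commute)
qed

lemma coeff_le_stft:
  assumes "integrable (count_space UNIV) (\<lambda>k. f k * cnj (g (k - m)))"
  shows "ennreal (norm (f k) * norm (g (k - m))) \<le> (\<integral>\<^sup>+w. ennreal (norm (stft g f m w)) \<partial>torus)"
  using fourier_coeff_bound[OF assms, of k] by (simp add: norm_mult stft_eq_fourier_series)

text \<open>The coefficient at \<open>k\<close> is read off at time \<open>m = k - k0\<close>, where
  the window always contributes the same value \<open>g0 k0\<close>; as \<open>k\<close> runs
  through the lattice, so does \<open>m\<close>.\<close>

lemma l1_le_M1_norm:
  assumes "g0 \<in> schwartz_Z" "f \<in> dual_schwartz_Z"
  shows "ennreal (norm (g0 k0)) * (\<integral>\<^sup>+k. ennreal (norm (f k)) \<partial>count_space UNIV) \<le> M1_norm g0 f"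
proof -
  have "ennreal (norm (g0 k0)) * (\<integral>\<^sup>+k. ennreal (norm (f k)) \<partial>count_space UNIV) =
      (\<integral>\<^sup>+k. ennreal (norm (f k) * norm (g0 k0)) \<partial>count_space UNIV)"
    by (simp add: nn_integral_cmult[symmetric] ennreal_mult mult.commute)
  also have "\<dots> \<le> (\<integral>\<^sup>+k. \<integral>\<^sup>+w. ennreal (norm (stft g0 f (k - k0) w)) \<partial>torus \<partial>count_space UNIV)"
    using coeff_le_stft[OF dual_schwartz_Z_integrable[OF assms(2,1)], of k "k - k0" for k]
    by (intro nn_integral_mono) simp
  also have "\<dots> = M1_norm g0 f"
    unfolding M1_norm_def
    by (rule nn_integral_count_space_diff(1)[where f = "\<lambda>m. \<integral>\<^sup>+w. ennreal (norm (stft g0 f m w)) \<partial>torus"])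
  finally show ?thesis .
qed

text \<open>As in \<open>l1_le_M1_norm\<close>, with Jensen's inequality on the torus, a space of
  mass 1, in place of the plain integral; hence the additional 2.\<close>

lemma seq_modular_le_stft_modular:
  assumes \<Phi>: "young_function \<Phi>" and b: "0 < b"
    and "g0 \<in> schwartz_Z" "f \<in> dual_schwartz_Z"
  shows "(\<integral>\<^sup>+k. \<Phi> (ennreal (norm (f k) / (2 * b / norm (g0 k0)))) \<partial>count_space UNIV) \<le>
    (\<integral>\<^sup>+m. \<integral>\<^sup>+w. \<Phi> (ennreal (norm (stft g0 f m w) / b)) \<partial>torus \<partial>count_space UNIV)"
proof -
  have "(\<integral>\<^sup>+k. \<Phi> (ennreal (norm (f k) / (2 * b / norm (g0 k0)))) \<partial>count_space UNIV) \<le>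
      (\<integral>\<^sup>+k. \<integral>\<^sup>+w. \<Phi> (ennreal (norm (stft g0 f (k - k0) w) / b)) \<partial>torus \<partial>count_space UNIV)"
  proof (rule nn_integral_mono)
    fix k
    have "\<Phi> (ennreal (norm (f k) / (2 * b / norm (g0 k0)))) \<le>
        (\<integral>\<^sup>+w. 1 * \<Phi> (ennreal (norm (stft g0 f (k - k0) w) / b)) \<partial>torus)"
    proof (rule young_jensen[OF \<Phi>])
      have "ennreal (2 * (norm (f k) / (2 * b / norm (g0 k0)))) = ennreal (1 / b) * ennreal (norm (f k) * norm (g0 (k - (k - k0))))"
        using b by (simp add: ennreal_mult'[symmetric] field_simps)
      also have "\<dots> \<le> ennreal (1 / b) * (\<integral>\<^sup>+w. ennreal (norm (stft g0 f (k - k0) w)) \<partial>torus)"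
        by (intro mult_left_mono coeff_le_stft dual_schwartz_Z_integrable assms) simp
      also have "\<dots> = (\<integral>\<^sup>+w. 1 * ennreal (norm (stft g0 f (k - k0) w) / b) \<partial>torus)"
        using b by (simp add: nn_integral_cmult[symmetric] ennreal_mult'[symmetric])
      finally show "ennreal (2 * (norm (f k) / (2 * b / norm (g0 k0)))) \<le>
        (\<integral>\<^sup>+w. 1 * ennreal (norm (stft g0 f (k - k0) w) / b) \<partial>torus)" .
    qed (use b in auto)
    then show "\<Phi> (ennreal (norm (f k) / (2 * b / norm (g0 k0)))) \<le>
        (\<integral>\<^sup>+w. \<Phi> (ennreal (norm (stft g0 f (k - k0) w) / b)) \<partial>torus)" by simp
  qed
  also have "\<dots> = (\<integral>\<^sup>+m. \<integral>\<^sup>+w. \<Phi> (ennreal (norm (stft g0 f m w) / b)) \<partial>torus \<partial>count_space UNIV)"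
    by (rule nn_integral_count_space_diff(1)[where
          f = "\<lambda>m. \<integral>\<^sup>+w. \<Phi> (ennreal (norm (stft g0 f m w) / b)) \<partial>torus"])
  finally show ?thesis .
qed

text \<open>The transform is bounded, uniformly in \<open>w\<close>, by the sum of |g0(k - m)|
  |f(k)| over \<open>k\<close>. Integration over \<open>w\<close> thus costs nothing, and Schur's
  test applies to the kernel |g0(k - m)|, whose rows and columns all sum to the l^1 norm of
  \<open>g0\<close>.\<close>

lemma stft_modular_le_seq_modular:
  fixes g0 f :: "int^'n \<Rightarrow> complex"
  assumes \<Phi>: "young_function \<Phi>" and b: "0 < b" and A: "0 < A"
    and g0: "(\<integral>\<^sup>+k. ennreal (norm (g0 k)) \<partial>count_space UNIV) \<le> ennreal A"
    and f: "\<And>k. norm (f k) \<le> D"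
  shows "(\<integral>\<^sup>+m. \<integral>\<^sup>+w. \<Phi> (ennreal (norm (stft g0 f m w) / (2 * A * b))) \<partial>torus \<partial>count_space UNIV) \<le>
    (\<integral>\<^sup>+k. \<Phi> (ennreal (norm (f k) / b)) \<partial>count_space UNIV)"
proof -
  define K where "K m k = ennreal (norm (g0 (k - m)))" for m k
  define F where "F m = (\<integral>\<^sup>+k. K m k * ennreal (norm (f k)) \<partial>count_space UNIV)" for m
  have rows: "(\<integral>\<^sup>+k. K m k \<partial>count_space UNIV) \<le> ennreal A"
    and cols: "(\<integral>\<^sup>+m. K m k \<partial>count_space UNIV) \<le> ennreal A" for m k
    using nn_integral_count_space_diff[of "\<lambda>k. ennreal (norm (g0 k))"] g0 by (auto simp: K_def)
  \<comment> \<open>Finiteness comes from the boundedness of \<open>f\<close>; without it,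
    \<open>enn2real\<close> would turn an infinite value into 0 and the bound would be lost.\<close>
  have "F m < top" for m
  proof -
    have "F m \<le> (\<integral>\<^sup>+k. K m k * ennreal D \<partial>count_space UNIV)"
      unfolding F_def by (intro nn_integral_mono mult_left_mono) (auto intro: ennreal_leI f)
    also have "\<dots> \<le> ennreal A * ennreal D"
      using rows by (simp add: nn_integral_multc mult_right_mono)
    finally show ?thesis by (simp add: ennreal_mult_less_top order_le_less_trans)
  qed
  then have F: "ennreal (enn2real (F m)) = F m" for m by simp
  have "(\<integral>\<^sup>+m. \<integral>\<^sup>+w. \<Phi> (ennreal (norm (stft g0 f m w) / (2 * A * b))) \<partial>torus \<partial>count_space UNIV)
      \<le> (\<integral>\<^sup>+m. \<integral>\<^sup>+w. \<Phi> (ennreal (enn2real (F m) / (2 * A * b))) \<partial>(torus :: (real^'n) measure) \<partial>count_space UNIV)"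
  proof (intro nn_integral_mono young_mono[OF \<Phi>] divide_right_mono)
    fix m and w :: "real^'n"
    have "ennreal (norm (stft g0 f m w)) \<le> ennreal (enn2real (F m))"
      unfolding F unfolding F_def K_def by (rule norm_stft_le)
    then show "norm (stft g0 f m w) \<le> enn2real (F m)" by (simp add: ennreal_le_iff)
  qed (use A b in auto)
  also have "\<dots> = (\<integral>\<^sup>+m. \<Phi> (ennreal (enn2real (F m) / (2 * A * b))) \<partial>count_space UNIV)"
    by simp
  also have "\<dots> \<le> (\<integral>\<^sup>+k. \<Phi> (ennreal (norm (f k) / b)) \<partial>count_space UNIV)"
    by (rule young_schur[OF \<Phi> A b rows cols]) (auto simp: F, auto simp: F_def)
  finally show ?thesis .
qed

section \<open>Integrability of the symbol\<close>

lemma partials_const: "\<exists>c'. partials ix (\<lambda>y. c) = (\<lambda>y. c')"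
proof (induction ix)
  case (Cons i ix)
  then obtain c' where "partials ix (\<lambda>y. c) = (\<lambda>y. c')" by blast
  then show ?case by (intro exI[of _ 0]) simp
qed auto

lemma partials_const_Cons: "partials (i # ix) (\<lambda>y. c) = (\<lambda>y. 0)"
  using partials_const[of ix c] by auto

lemma schwartz_Z_const_in_schwartz_ZT:
  fixes a :: "int^'n \<Rightarrow> complex"
  assumes "a \<in> schwartz_Z"
  shows "(\<lambda>k y. a k) \<in> schwartz_ZT"
proof -
  have "\<exists>C. \<forall>k w. norm (partials ix (\<lambda>y. a k) (w :: real^'n)) \<le> C / (1 + norm (rvec k)) ^ M" for ix and M :: nat
  proof (cases ix)
    case Nil
    then show ?thesis using assms by (auto simp: schwartz_Z_def)
  next
    case (Cons i ix')
    then show ?thesis by (intro exI[of _ 0]) (simp add: partials_const_Cons del: partials.simps)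
  qed
  moreover have "smooth_fun (\<lambda>y :: real^'n. a k)" for k
    unfolding smooth_fun_def
  proof (intro allI)
    fix ix and x :: "real^'n"
    obtain c' where "partials ix (\<lambda>y :: real^'n. a k) = (\<lambda>y. c')" using partials_const by blast
    then show "partials ix (\<lambda>y :: real^'n. a k) differentiable at x" by simp
  qed
  ultimately show ?thesis
    by (simp add: schwartz_ZT_def periodic_def)
qed

text \<open>\<open>\<sigma>\<close> is tested against functions constant in \<open>y\<close>.
  Bochner integrability is absolute, so these control the L^1 norms of the slices, and a unit
  sequence singles out one slice.\<close>

lemma dual_schwartz_ZT_integrable:
  assumes \<sigma>: "\<sigma> \<in> dual_schwartz_ZT"
  shows "integrable torus (\<sigma> k)"
    and "a \<in> schwartz_Z \<Longrightarrow>
      (\<integral>\<^sup>+k. \<integral>\<^sup>+y. ennreal (norm (\<sigma> k y) * norm (a k)) \<partial>torus \<partial>count_space UNIV) < \<infinity>"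
proof -
  interpret pair_sigma_finite "count_space (UNIV :: (int^'a) set)" "torus :: (real^'a) measure"
    by (rule pair_sigma_finite_count_torus)
  have int: "integrable (count_space UNIV \<Otimes>\<^sub>M torus) (\<lambda>(k, y). \<sigma> k y * a k)" if "a \<in> schwartz_Z" for a
    using \<sigma> schwartz_Z_const_in_schwartz_ZT[OF that]
    unfolding dual_schwartz_ZT_def ztorus_def by fastforce
  have fin: "(\<integral>\<^sup>+k. \<integral>\<^sup>+y. ennreal (norm (\<sigma> k y) * norm (a k)) \<partial>torus \<partial>count_space UNIV) < \<infinity>"
    if "a \<in> schwartz_Z" for a
  proof -
    have m: "(\<lambda>p. ennreal (norm ((\<lambda>(k, y). \<sigma> k y * a k) p))) \<in> borel_measurable (count_space UNIV \<Otimes>\<^sub>M torus)"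
      using borel_measurable_integrable[OF int[OF that]] by measurable
    show ?thesis
      using int[OF that] torus.nn_integral_fst[OF m]
      by (simp add: integrable_iff_bounded norm_mult)
  qed
  then show "a \<in> schwartz_Z \<Longrightarrow>
      (\<integral>\<^sup>+k. \<integral>\<^sup>+y. ennreal (norm (\<sigma> k y) * norm (a k)) \<partial>torus \<partial>count_space UNIV) < \<infinity>" .
  define \<delta> :: "int^'a \<Rightarrow> complex" where "\<delta> j = of_bool (j = k)" for j
  have \<delta>: "\<delta> \<in> schwartz_Z"
    unfolding schwartz_Z_def
  proof (intro CollectI allI)
    fix M :: nat
    have "1 + norm (rvec k) \<noteq> 0" using norm_ge_zero[of "rvec k"] by linarith
    then show "\<exists>C. \<forall>j. norm (\<delta> j) \<le> C / (1 + norm (rvec j)) ^ M"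
      by (intro exI[of _ "(1 + norm (rvec k)) ^ M"])
        (auto simp: \<delta>_def of_bool_def add_pos_nonneg intro!: divide_nonneg_nonneg)
  qed
  have "(\<lambda>y. (\<lambda>(k, y). \<sigma> k y * \<delta> k) (k, y)) \<in> borel_measurable torus"
    by (rule measurable_compose[OF measurable_Pair1' borel_measurable_integrable[OF int[OF \<delta>]]]) simp
  then have m: "\<sigma> k \<in> borel_measurable torus" by (simp add: \<delta>_def)
  have "(\<integral>\<^sup>+y. ennreal (norm (\<sigma> k y)) \<partial>torus) = (\<integral>\<^sup>+y. ennreal (norm (\<sigma> k y) * norm (\<delta> k)) \<partial>torus)"
    by (simp add: \<delta>_def)
  also have "\<dots> \<le> (\<integral>\<^sup>+k. \<integral>\<^sup>+y. ennreal (norm (\<sigma> k y) * norm (\<delta> k)) \<partial>torus \<partial>count_space UNIV)"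
    by (rule le_nn_integral_count_space[where f = "\<lambda>k. \<integral>\<^sup>+y. ennreal (norm (\<sigma> k y) * norm (\<delta> k)) \<partial>torus"])
  also have "\<dots> < \<infinity>" by (rule fin[OF \<delta>])
  finally show "integrable torus (\<sigma> k)"
    using m by (simp add: integrable_iff_bounded)
qed

text \<open>
  The short-time Fourier transform at \<open>(m, w)\<close> bounds the coefficients of the functions
  \<open>\<sigma> k * G (k - m) (\<cdot> - w)\<close>, hence their \<open>L\<^sup>1\<close> norms. Taking \<open>m = k - k1\<close> and averaging over \<open>w\<close>
  removes the window.
\<close>

lemma L1_le_M1_norm_ZT:
  fixes G :: "int^'n \<Rightarrow> real^'n \<Rightarrow> complex"
  assumes \<sigma>: "\<sigma> \<in> dual_schwartz_ZT"
    and per: "\<And>k. periodic (G k)" and cont: "\<And>k. continuous_on UNIV (G k)"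
    and a: "a \<in> schwartz_Z" "\<And>k y. norm (G k y) \<le> norm (a k)"
  shows "(\<integral>\<^sup>+y. ennreal (norm (G k1 y)) \<partial>torus) *
      (\<integral>\<^sup>+k. \<integral>\<^sup>+y. ennreal (norm (\<sigma> k y)) \<partial>torus \<partial>count_space UNIV) \<le> M1_norm_ZT G \<sigma>"
proof -
  define N where "N m w = (\<integral>\<^sup>+x. \<integral>\<^sup>+l. ennreal (norm (stft_ZT G \<sigma> m w x l)) \<partial>count_space UNIV \<partial>torus)"
    for m and w :: "real^'n"
  note \<sigma>_int = dual_schwartz_ZT_integrable[OF \<sigma>]
  have [measurable]: "\<sigma> k \<in> borel_measurable torus" for k using \<sigma>_int(1)[of k] by simp
  have [measurable]: "G k \<in> borel_measurable borel" for k
    by (rule borel_measurable_continuous_onI[OF cont])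
  have id [measurable]: "(\<lambda>y. y) \<in> measurable torus (borel :: (real^'n) measure)"
    by (rule borel_measurable_torus) simp
  have *: "(\<integral>\<^sup>+y. ennreal (norm (\<sigma> k y)) * ennreal (norm (G (k - m) (y - w))) \<partial>torus) \<le> N m w" for k m w
  proof -
    define h where "h j y = \<sigma> j y * cnj (G (j - m) (y - w))" for j y
    have cont': "continuous_on UNIV (\<lambda>y. cnj (G (j - m) (y - w)))" for j
      by (intro continuous_on_compose2[OF cont] continuous_intros) auto
    have [measurable]: "h j \<in> borel_measurable torus" for j
      unfolding h_def by (intro borel_measurable_times continuous_imp_measurable_torus[OF cont']) simp
    have h_le: "norm (h j y) \<le> norm (\<sigma> j y) * norm (translation m a j)" for j y
      using a(2) by (auto simp: h_def norm_mult translation_def intro: mult_left_mono)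
    have h_int: "integrable torus (h j)" for j
    proof (rule Bochner_Integration.integrable_bound)
      show "integrable torus (\<lambda>y. translation m a j * \<sigma> j y)"
        by (intro integrable_mult_right \<sigma>_int)
      show "AE y in torus. norm (h j y) \<le> norm (translation m a j * \<sigma> j y)"
        using h_le by (intro AE_I2) (auto simp: norm_mult mult.commute)
    qed simp
    \<comment> \<open>For fixed \<open>l\<close> the transform is a Fourier series in
      \<open>x\<close> with the coefficients \<open>c l j\<close>, which are in turn Fourier
      coefficients in \<open>y\<close> of \<open>h j\<close>. So \<open>fourier_coeff_bound\<close>
      isolates \<open>j = k\<close>, and \<open>fourier_L1_bound_nn\<close> then treats the sum over
      \<open>l\<close>.\<close>
    define c where "c l j = (LINT y|torus. h j y * character (- l) y)" for l j
    have c_int: "integrable (count_space UNIV) (c l)" for l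
    proof (subst integrable_iff_bounded, intro conjI)
      have "ennreal (norm (c l j)) \<le> (\<integral>\<^sup>+y. ennreal (norm (\<sigma> j y) * norm (translation m a j)) \<partial>torus)" for j
      proof -
        have "integrable torus (\<lambda>y. h j y * character (- l) y)"
          by (rule Bochner_Integration.integrable_bound[OF h_int[of j]]) (auto simp: norm_mult)
        then have "ennreal (norm (c l j)) \<le> (\<integral>\<^sup>+y. ennreal (norm (h j y * character (- l) y)) \<partial>torus)"
          unfolding c_def by (rule integral_norm_bound_ennreal)
        also have "\<dots> \<le> (\<integral>\<^sup>+y. ennreal (norm (\<sigma> j y) * norm (translation m a j)) \<partial>torus)"
          by (intro nn_integral_mono ennreal_leI) (simp add: norm_mult h_le)
        finally show ?thesis .
      qed
      then have "(\<integral>\<^sup>+j. ennreal (norm (c l j)) \<partial>count_space UNIV)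
          \<le> (\<integral>\<^sup>+j. \<integral>\<^sup>+y. ennreal (norm (\<sigma> j y) * norm (translation m a j)) \<partial>torus \<partial>count_space UNIV)"
        by (intro nn_integral_mono)
      also have "\<dots> < \<infinity>" by (intro \<sigma>_int translation_schwartz_Z a)
      finally show "(\<integral>\<^sup>+j. ennreal (norm (c l j)) \<partial>count_space UNIV) < \<infinity>" .
    qed simp
    have V: "stft_ZT G \<sigma> m w x l = (\<Sum>\<^sub>\<infinity>j. c l j * cnj (character j x))" for x l
    proof -
      have "exp (- 2 * complex_of_real pi * \<i> * (complex_of_real (x \<bullet> rvec j) + complex_of_real (rvec l \<bullet> y)))
          = cis (- (2 * pi * (x \<bullet> rvec j + rvec l \<bullet> y)))" for j y
        unfolding cis_conv_exp by (simp add: algebra_simps)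
      also have "cis (- (2 * pi * (x \<bullet> rvec j + rvec l \<bullet> y))) = character (- l) y * cnj (character j x)" for j y
        by (simp add: character_def cis_cnj cis_mult inner_commute algebra_simps)
      finally have "exp (- 2 * complex_of_real pi * \<i> * (complex_of_real (x \<bullet> rvec j) + complex_of_real (rvec l \<bullet> y)))
          = character (- l) y * cnj (character j x)" for j y .
      then have "(LINT y|torus. \<sigma> j y * cnj (G (j - m) (y - w)) *
          exp (- 2 * complex_of_real pi * \<i> * complex_of_real (x \<bullet> rvec j + rvec l \<bullet> y)))
          = (LINT y|torus. (h j y * character (- l) y) * cnj (character j x))" for j
        by (intro Bochner_Integration.integral_cong refl) (simp add: h_def mult.assoc)
      then have "(LINT y|torus. \<sigma> j y * cnj (G (j - m) (y - w)) *
          exp (- 2 * complex_of_real pi * \<i> * complex_of_real (x \<bullet> rvec j + rvec l \<bullet> y)))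
          = c l j * cnj (character j x)" for j
        by (simp only: c_def integral_mult_left_zero)
      then show ?thesis
        unfolding stft_ZT_def by simp
    qed
    have "(\<integral>\<^sup>+y. ennreal (norm (\<sigma> k y)) * ennreal (norm (G (k - m) (y - w))) \<partial>torus)
        = (\<integral>\<^sup>+y. ennreal (norm (h k y)) \<partial>torus)"
      by (simp add: h_def norm_mult ennreal_mult)
    \<comment> \<open>\<open>fourier_L1_bound_nn\<close> integrates against
      \<open>character l\<close>, the transform against its conjugate; the sign is removed by
      reindexing.\<close>
    also have "\<dots> \<le> (\<integral>\<^sup>+l. ennreal (norm (c (0 - l) k)) \<partial>count_space UNIV)"
      using fourier_L1_bound_nn[OF h_int[of k]] by (simp add: c_def)
    also have "\<dots> = (\<integral>\<^sup>+l. ennreal (norm (c l k)) \<partial>count_space UNIV)"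
      by (rule nn_integral_count_space_diff(2)[where f = "\<lambda>l. ennreal (norm (c l k))"])
    also have "\<dots> \<le> (\<integral>\<^sup>+l. \<integral>\<^sup>+x. ennreal (norm (stft_ZT G \<sigma> m w x l)) \<partial>torus \<partial>count_space UNIV)"
      unfolding V by (intro nn_integral_mono fourier_coeff_bound c_int)
    also have "\<dots> = N m w"
      unfolding N_def V
      by (intro nn_integral_count_space_nn_integral[symmetric] countableI_type
          measurable_compose[OF fourier_series_measurable] measurable_compose[OF borel_measurable_norm]) simp_all
    finally show ?thesis .
  qed
  define q where "q = (\<integral>\<^sup>+y. ennreal (norm (G k1 y)) \<partial>torus)"
  have "q * (\<integral>\<^sup>+y. ennreal (norm (\<sigma> k y)) \<partial>torus) \<le> (\<integral>\<^sup>+w. N (k - k1) w \<partial>torus)" for k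
  proof -
    interpret T: pair_sigma_finite "torus :: (real^'n) measure" "torus :: (real^'n) measure"
      by (simp add: pair_sigma_finite_def torus.sigma_finite_measure_axioms)
    have "q * (\<integral>\<^sup>+y. ennreal (norm (\<sigma> k y)) \<partial>torus) = (\<integral>\<^sup>+y. ennreal (norm (\<sigma> k y)) * q \<partial>torus)"
      by (subst nn_integral_multc) (simp_all add: mult.commute)
    also have "\<dots> = (\<integral>\<^sup>+y. \<integral>\<^sup>+w. ennreal (norm (\<sigma> k y)) * ennreal (norm (G k1 (y - w))) \<partial>torus \<partial>torus)"
    proof (rule nn_integral_cong)
      fix y :: "real^'n"
      \<comment> \<open>The average of the shifted window over \<open>w\<close> does not depend on
        \<open>y\<close>, so the window leaves the integral as the constant
        \<open>q\<close>.\<close>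
      have "q = (\<integral>\<^sup>+w. ennreal (norm (G k1 (y - w))) \<partial>torus)"
        unfolding q_def using per[of k1]
        by (intro nn_integral_torus_reflect[symmetric, where f = "\<lambda>y. ennreal (norm (G k1 y))"])
          (auto simp: periodic_def)
      then show "ennreal (norm (\<sigma> k y)) * q =
          (\<integral>\<^sup>+w. ennreal (norm (\<sigma> k y)) * ennreal (norm (G k1 (y - w))) \<partial>torus)"
        by (simp add: nn_integral_cmult)
    qed
    also have "\<dots> = (\<integral>\<^sup>+w. \<integral>\<^sup>+y. ennreal (norm (\<sigma> k y)) * ennreal (norm (G k1 (y - w))) \<partial>torus \<partial>torus)"
      by (rule T.Fubini') simp
    also have "\<dots> \<le> (\<integral>\<^sup>+w. N (k - k1) w \<partial>torus)"
      using *[of k "k - k1"] by (intro nn_integral_mono) simp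
    finally show ?thesis .
  qed
  then have "q * (\<integral>\<^sup>+k. \<integral>\<^sup>+y. ennreal (norm (\<sigma> k y)) \<partial>torus \<partial>count_space UNIV)
      \<le> (\<integral>\<^sup>+k. \<integral>\<^sup>+w. N (k - k1) w \<partial>torus \<partial>count_space UNIV)"
    by (simp add: nn_integral_cmult[symmetric] nn_integral_mono)
  also have "\<dots> = (\<integral>\<^sup>+m. \<integral>\<^sup>+w. N m w \<partial>torus \<partial>count_space UNIV)"
    by (rule nn_integral_count_space_diff(1)[where f = "\<lambda>m. \<integral>\<^sup>+w. N m w \<partial>torus"])
  finally show ?thesis
    unfolding q_def N_def M1_norm_ZT_def .
qed

section \<open>What is needed of the window \<open>G0\<close>\<close>

lemma schwartz_ZT_continuous:
  assumes "G \<in> schwartz_ZT"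
  shows "continuous_on UNIV (G k)"
proof -
  have "smooth_fun (G k)" using assms by (simp add: schwartz_ZT_def)
  then have "partials [] (G k) differentiable at x" for x unfolding smooth_fun_def by blast
  then show ?thesis
    by (simp add: continuous_at_imp_continuous_on differentiable_imp_continuous_within)
qed

text \<open>The supremum over \<open>y\<close> inherits the decay in \<open>k\<close>. Being
  constant in \<open>y\<close>, such an envelope fits
  \<open>dual_schwartz_ZT_integrable\<close>.\<close>

lemma schwartz_ZT_envelope:
  fixes G :: "int^'n \<Rightarrow> real^'n \<Rightarrow> complex"
  assumes "G \<in> schwartz_ZT"
  obtains a where "a \<in> schwartz_Z" "\<And>k y. norm (G k y) \<le> norm (a k)"
proof -
  have decay: "\<exists>C. \<forall>k w. norm (G k w) \<le> C / (1 + norm (rvec k)) ^ M" for M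
  proof -
    have "\<forall>ix. \<forall>M::nat. \<exists>C. \<forall>k w. norm (partials ix (G k) w) \<le> C / (1 + norm (rvec k)) ^ M"
      using assms by (simp add: schwartz_ZT_def)
    from this[rule_format, of "[]" M] show ?thesis by simp
  qed
  define s where "s k = (SUP y. norm (G k y))" for k
  obtain C0 where C0: "\<And>k w. norm (G k w) \<le> C0 / (1 + norm (rvec k)) ^ 0" using decay by metis
  have bdd: "bdd_above (range (\<lambda>y. norm (G k y)))" for k
    using C0 by (intro bdd_aboveI[of _ C0]) auto
  have upper: "norm (G k y) \<le> s k" for k y
    unfolding s_def by (rule cSUP_upper[OF UNIV_I bdd])
  have "0 \<le> s k" for k using upper[of k 0] norm_ge_zero order_trans by blast
  have "(\<lambda>k. complex_of_real (s k)) \<in> schwartz_Z"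
    unfolding schwartz_Z_def
  proof (intro CollectI allI)
    fix M
    obtain C where "\<And>k w. norm (G k w) \<le> C / (1 + norm (rvec k)) ^ M" using decay by metis
    then have "s k \<le> C / (1 + norm (rvec k)) ^ M" for k
      unfolding s_def by (intro cSUP_least) auto
    with \<open>\<And>k. 0 \<le> s k\<close> show "\<exists>C. \<forall>k. norm (complex_of_real (s k)) \<le> C / (1 + norm (rvec k)) ^ M"
      by auto
  qed
  then show ?thesis
    using upper \<open>\<And>k. 0 \<le> s k\<close> by (intro that[of "\<lambda>k. complex_of_real (s k)"]) auto
qed

text \<open>The point \<open>y0\<close> may lie outside the cube or on its boundary. Reflection at
  \<open>y0 + ?c\<close> carries it to the centre \<open>?c\<close>, around which an open set inside
  the cube has positive measure.\<close>

lemma nn_integral_torus_pos: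
  fixes g :: "real^'n \<Rightarrow> complex"
  assumes cont: "continuous_on UNIV g" and per: "periodic g" and ne: "g y0 \<noteq> 0"
  shows "0 < (\<integral>\<^sup>+y. ennreal (norm (g y)) \<partial>torus)"
proof (rule ccontr)
  have [measurable]: "g \<in> borel_measurable borel"
    by (rule borel_measurable_continuous_onI[OF cont])
  let ?c = "(\<chi> i. 1/2) :: real^'n"
  let ?U = "box 0 1 \<inter> {y. g ((y0 + ?c) - y) \<noteq> 0}"
  assume "\<not> ?thesis"
  then have "(\<integral>\<^sup>+y. ennreal (norm (g y)) \<partial>torus) = 0" by simp
  then have "(\<integral>\<^sup>+y. ennreal (norm (g ((y0 + ?c) - y))) \<partial>torus) = 0"
    using nn_integral_torus_reflect[of "\<lambda>y. ennreal (norm (g y))" "y0 + ?c"] per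
    by (simp add: periodic_def)
  then have "AE y in torus. g ((y0 + ?c) - y) = 0"
    by (subst (asm) nn_integral_0_iff_AE)
      (auto intro!: borel_measurable_torus measurable_compose[OF _ measurable_ennreal])
  then have "AE y in lborel. y \<in> cbox 0 1 \<longrightarrow> g ((y0 + ?c) - y) = 0"
    unfolding torus_def by (subst (asm) AE_restrict_space_iff) auto
  then have ae: "AE y in lborel. y \<notin> ?U"
    by eventually_elim (use box_subset_cbox in auto)
  have op: "open ?U"
  proof (intro open_Int open_box open_Collect_neq)
    show "continuous_on UNIV (\<lambda>y. g ((y0 + ?c) - y))"
      by (intro continuous_on_compose2[OF cont] continuous_intros) auto
  qed simp
  then have "?U \<in> null_sets lborel"
    using ae by (subst AE_iff_null_sets) auto
  then have "negligible ?U"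
    by (simp add: negligible_iff_null_sets null_sets_completionI)
  moreover have "?c \<in> ?U"
    using ne by (auto simp: mem_box_cart)
  ultimately show False
    using open_not_negligible op by blast
qed

section \<open>The localization operator\<close>

lemma norm_localization_summand:
  "norm (\<sigma> m w * stft g1 f m w * modulation w (translation m g2) k) =
    norm (\<sigma> m w) * norm (stft g1 f m w) * norm (g2 (k - m))"
  by (simp add: modulation_def translation_def exp_eq_character norm_mult)

text \<open>\<open>s m\<close> stands for the L^1 norm of the slice \<open>\<sigma> m\<close>. With
  values in \<open>ennreal\<close>, sums can be exchanged before anything is known to be
  finite.\<close>

definition localization_kernel where
  "localization_kernel s g1 g2 k j =
    (\<integral>\<^sup>+m. s m * ennreal (norm (g2 (k - m))) * ennreal (norm (g1 (j - m))) \<partial>count_space UNIV)"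

lemma le_linf_norm: "ennreal (norm (g k)) \<le> linf_norm g"
  unfolding linf_norm_def by (rule SUP_upper) simp

lemma localization_kernel_rows:
  fixes g1 g2 :: "int^'n \<Rightarrow> complex"
  shows "(\<integral>\<^sup>+j. localization_kernel s g1 g2 k j \<partial>count_space UNIV) \<le>
    (\<integral>\<^sup>+m. s m \<partial>count_space UNIV) * linf_norm g2 * (\<integral>\<^sup>+j. ennreal (norm (g1 j)) \<partial>count_space UNIV)"
proof -
  have "(\<integral>\<^sup>+j. localization_kernel s g1 g2 k j \<partial>count_space UNIV) =
      (\<integral>\<^sup>+m. \<integral>\<^sup>+j. s m * ennreal (norm (g2 (k - m))) * ennreal (norm (g1 (j - m))) \<partial>count_space UNIV \<partial>count_space UNIV)"
    unfolding localization_kernel_def by (rule nn_integral_count_space_swap)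
  also have "\<dots> = (\<integral>\<^sup>+m. s m * ennreal (norm (g2 (k - m))) * (\<integral>\<^sup>+j. ennreal (norm (g1 j)) \<partial>count_space UNIV) \<partial>count_space UNIV)"
    using nn_integral_count_space_diff(1)[of "\<lambda>j. ennreal (norm (g1 j))"]
    by (simp add: nn_integral_cmult)
  also have "\<dots> \<le> (\<integral>\<^sup>+m. s m * linf_norm g2 * (\<integral>\<^sup>+j. ennreal (norm (g1 j)) \<partial>count_space UNIV) \<partial>count_space UNIV)"
    by (intro nn_integral_mono mult_right_mono mult_left_mono le_linf_norm) auto
  finally show ?thesis by (simp add: nn_integral_multc)
qed

text \<open>Column sums become row sums with the windows exchanged; this is the origin of the two
  entries of the maximum.\<close>

lemma localization_kernel_commute:
  "localization_kernel s g1 g2 k j = localization_kernel s g2 g1 j k"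
  by (simp add: localization_kernel_def mult_ac)

lemma localization_kernel_bound:
  fixes g1 g2 f :: "int^'n \<Rightarrow> complex"
  assumes [measurable]: "\<And>m. \<sigma> m \<in> borel_measurable torus"
  shows "(\<integral>\<^sup>+m. \<integral>\<^sup>+w. ennreal (norm (\<sigma> m w * stft g1 f m w * modulation w (translation m g2) k)) \<partial>torus \<partial>count_space UNIV)
    \<le> (\<integral>\<^sup>+j. localization_kernel (\<lambda>m. \<integral>\<^sup>+w. ennreal (norm (\<sigma> m w)) \<partial>torus) g1 g2 k j * ennreal (norm (f j)) \<partial>count_space UNIV)"
proof -
  define s where "s m = (\<integral>\<^sup>+w. ennreal (norm (\<sigma> m w)) \<partial>torus)" for m
  have "(\<integral>\<^sup>+m. \<integral>\<^sup>+w. ennreal (norm (\<sigma> m w * stft g1 f m w * modulation w (translation m g2) k)) \<partial>torus \<partial>count_space UNIV)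
      \<le> (\<integral>\<^sup>+m. \<integral>\<^sup>+j. s m * ennreal (norm (g2 (k - m))) * ennreal (norm (g1 (j - m))) * ennreal (norm (f j)) \<partial>count_space UNIV \<partial>count_space UNIV)"
  proof (rule nn_integral_mono)
    fix m
    define R where "R = (\<integral>\<^sup>+j. ennreal (norm (g1 (j - m))) * ennreal (norm (f j)) \<partial>count_space UNIV)"
    have "(\<integral>\<^sup>+w. ennreal (norm (\<sigma> m w * stft g1 f m w * modulation w (translation m g2) k)) \<partial>torus)
        \<le> (\<integral>\<^sup>+w. ennreal (norm (\<sigma> m w)) * (R * ennreal (norm (g2 (k - m)))) \<partial>torus)"
      unfolding norm_localization_summand R_def
      by (auto simp: ennreal_mult mult.assoc intro!: nn_integral_mono mult_right_mono mult_left_mono norm_stft_le)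
    also have "\<dots> = s m * ennreal (norm (g2 (k - m))) * R"
      by (subst nn_integral_multc) (simp_all add: s_def mult_ac)
    also have "\<dots> = (\<integral>\<^sup>+j. s m * ennreal (norm (g2 (k - m))) * ennreal (norm (g1 (j - m))) * ennreal (norm (f j)) \<partial>count_space UNIV)"
      by (simp add: R_def nn_integral_cmult[symmetric] mult.assoc)
    finally show "(\<integral>\<^sup>+w. ennreal (norm (\<sigma> m w * stft g1 f m w * modulation w (translation m g2) k)) \<partial>torus) \<le> \<dots>" .
  qed
  also have "\<dots> = (\<integral>\<^sup>+j. \<integral>\<^sup>+m. s m * ennreal (norm (g2 (k - m))) * ennreal (norm (g1 (j - m))) * ennreal (norm (f j)) \<partial>count_space UNIV \<partial>count_space UNIV)"
    by (rule nn_integral_count_space_swap)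
  also have "\<dots> = (\<integral>\<^sup>+j. localization_kernel s g1 g2 k j * ennreal (norm (f j)) \<partial>count_space UNIV)"
    by (simp add: localization_kernel_def nn_integral_multc)
  finally show ?thesis by (simp add: s_def[abs_def])
qed

lemma norm_localization_le:
  fixes g1 g2 f :: "int^'n \<Rightarrow> complex"
  shows "ennreal (norm (localization \<sigma> g1 g2 f k)) \<le>
    (\<integral>\<^sup>+m. \<integral>\<^sup>+w. ennreal (norm (\<sigma> m w * stft g1 f m w * modulation w (translation m g2) k)) \<partial>torus \<partial>count_space UNIV)"
proof -
  have "ennreal (norm (LINT w|torus. F w)) \<le> (\<integral>\<^sup>+w. ennreal (norm (F w)) \<partial>torus)"
    for F :: "real^'n \<Rightarrow> complex"
    by (cases "integrable torus F") (auto simp: integral_norm_bound_ennreal not_integrable_integral_eq)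
  then show ?thesis
    unfolding localization_def
    by (intro order_trans[OF norm_infsum_le_nn_integral] nn_integral_mono)
qed

section \<open>Absolute convergence and linearity\<close>

lemma localization_summand_measurable:
  assumes [measurable]: "\<sigma> m \<in> borel_measurable torus"
  shows "(\<lambda>w. \<sigma> m w * stft g1 f m w * modulation w (translation m g2) k) \<in> borel_measurable torus"
proof -
  have "modulation w (translation m g2) k = character k w * translation m g2 k" for w
    by (simp add: modulation_def exp_eq_character)
  then show ?thesis by simp
qed

text \<open>By Tonelli a single finite integral of absolute values supplies every convergence
  statement: jointly, on each slice, and for the outer sum.\<close>

lemma localization_summand_integrable:
  fixes g1 g2 f :: "int^'n \<Rightarrow> complex"
  assumes [measurable]: "\<And>m. \<sigma> m \<in> borel_measurable torus"
    and fin: "(\<integral>\<^sup>+m. \<integral>\<^sup>+w. ennreal (norm (\<sigma> m w * stft g1 f m w * modulation w (translation m g2) k)) \<partial>torus \<partial>count_space UNIV) < \<infinity>"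
  shows "integrable ztorus (\<lambda>(m, w). \<sigma> m w * stft g1 f m w * modulation w (translation m g2) k)"
    and "integrable torus (\<lambda>w. \<sigma> m w * stft g1 f m w * modulation w (translation m g2) k)"
    and "(\<lambda>m. LINT w|torus. \<sigma> m w * stft g1 f m w * modulation w (translation m g2) k) summable_on UNIV"
proof -
  define I where "I m w = \<sigma> m w * stft g1 f m w * modulation w (translation m g2) k" for m w
  have [measurable]: "I m \<in> borel_measurable torus" for m
    unfolding I_def by (rule localization_summand_measurable) simp
  have fin': "(\<integral>\<^sup>+m. \<integral>\<^sup>+w. ennreal (norm (I m w)) \<partial>torus \<partial>count_space UNIV) < \<infinity>"
    using fin by (simp add: I_def)
  have meas: "(\<lambda>(m, w). I m w) \<in> borel_measurable (count_space UNIV \<Otimes>\<^sub>M torus)"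
    by (rule measurable_ztorusI) simp
  then have "(\<lambda>p. ennreal (norm ((\<lambda>(m, w). I m w) p))) \<in> borel_measurable (count_space UNIV \<Otimes>\<^sub>M torus)"
    by measurable
  from torus.nn_integral_fst[OF this] fin' meas
  show "integrable ztorus (\<lambda>(m, w). \<sigma> m w * stft g1 f m w * modulation w (translation m g2) k)"
    unfolding ztorus_def I_def[symmetric] by (simp add: integrable_iff_bounded)
  have int: "integrable torus (I m)" for m
    using le_nn_integral_count_space[of "\<lambda>m. \<integral>\<^sup>+w. ennreal (norm (I m w)) \<partial>torus" m] fin'
    by (auto simp: integrable_iff_bounded intro: order_le_less_trans)
  then show "integrable torus (\<lambda>w. \<sigma> m w * stft g1 f m w * modulation w (translation m g2) k)"
    by (simp add: I_def[abs_def])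
  have "(\<integral>\<^sup>+m. ennreal (norm (LINT w|torus. I m w)) \<partial>count_space UNIV)
      \<le> (\<integral>\<^sup>+m. \<integral>\<^sup>+w. ennreal (norm (I m w)) \<partial>torus \<partial>count_space UNIV)"
    using int by (intro nn_integral_mono integral_norm_bound_ennreal)
  also note fin'
  finally show "(\<lambda>m. LINT w|torus. \<sigma> m w * stft g1 f m w * modulation w (translation m g2) k) summable_on UNIV"
    unfolding summable_on_iff_integrable_count_space I_def[symmetric] by (simp add: integrable_iff_bounded)
qed

lemma stft_add:
  assumes "integrable (count_space UNIV) (\<lambda>k. f k * cnj (g (k - m)))"
    and "integrable (count_space UNIV) (\<lambda>k. h k * cnj (g (k - m)))"
  shows "stft g (\<lambda>k. f k + h k) m w = stft g f m w + stft g h m w"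
proof -
  have int: "integrable (count_space UNIV) (\<lambda>k. u k * cnj (g (k - m)) * cnj (character k w))"
    if "integrable (count_space UNIV) (\<lambda>k. u k * cnj (g (k - m)))" for u
    by (rule Bochner_Integration.integrable_bound[OF that]) (auto simp: norm_mult)
  show ?thesis
    unfolding stft_eq_fourier_series infsum_eq_integral_count_space distrib_right
    by (intro Bochner_Integration.integral_add int assms)
qed

text \<open>Unlike additivity, this holds for arbitrary \<open>f\<close>: a scalar leaves sums and
  integrals even where they take their default value.\<close>

lemma localization_cmult:
  "localization \<sigma> g1 g2 (\<lambda>k. c * f k) = (\<lambda>k. c * localization \<sigma> g1 g2 f k)"
proof
  fix k
  have "stft g1 (\<lambda>k. c * f k) m w = c * stft g1 f m w" for m w
    unfolding stft_def by (simp add: mult.assoc infsum_cmult_right')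
  then have "(\<lambda>w. \<sigma> m w * stft g1 (\<lambda>k. c * f k) m w * modulation w (translation m g2) k) =
      (\<lambda>w. c * (\<sigma> m w * stft g1 f m w * modulation w (translation m g2) k))" for m
    by (simp add: fun_eq_iff mult_ac)
  then show "localization \<sigma> g1 g2 (\<lambda>k. c * f k) k = c * localization \<sigma> g1 g2 f k"
    unfolding localization_def by (simp only: integral_mult_right_zero infsum_cmult_right')
qed

text \<open>Every admissible \<open>b\<close> for \<open>F\<close> makes \<open>x * b\<close>
  admissible for \<open>H\<close>. With \<open>x\<close> moved to the left side, the infimum over
  \<open>b\<close> needs no case distinction for an empty set of admissible values.\<close>

lemma orlicz_norm_le_mult:
  assumes x: "0 < x"
    and le: "\<And>b. 0 < b \<Longrightarrow>
      (\<integral>\<^sup>+m. \<integral>\<^sup>+w. \<Phi> (ennreal (norm (F m w) / b)) \<partial>torus \<partial>count_space UNIV) \<le> 1 \<Longrightarrow>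
      (\<integral>\<^sup>+m. \<integral>\<^sup>+w. \<Phi> (ennreal (norm (H m w) / (x * b))) \<partial>torus \<partial>count_space UNIV) \<le> 1"
  shows "orlicz_norm \<Phi> H \<le> ennreal x * orlicz_norm \<Phi> F"
proof -
  have xx: "ennreal (1 / x) * ennreal x = 1" using x by (simp add: ennreal_mult'[symmetric])
  have "ennreal (1 / x) * orlicz_norm \<Phi> H \<le> orlicz_norm \<Phi> F"
    unfolding orlicz_norm_def[of \<Phi> F]
  proof (rule Inf_greatest, clarify)
    fix b :: real assume b: "0 < b"
      "(\<integral>\<^sup>+m. \<integral>\<^sup>+w. \<Phi> (ennreal (norm (F m w) / b)) \<partial>torus \<partial>count_space UNIV) \<le> 1"
    have "orlicz_norm \<Phi> H \<le> ennreal (x * b)"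
      unfolding orlicz_norm_def using le[OF b] x b by (intro Inf_lower) auto
    then have "ennreal (1 / x) * orlicz_norm \<Phi> H \<le> ennreal (1 / x) * ennreal (x * b)"
      by (rule mult_left_mono) simp
    also have "\<dots> = ennreal b" using x b by (simp add: ennreal_mult'[symmetric])
    finally show "ennreal (1 / x) * orlicz_norm \<Phi> H \<le> ennreal b" .
  qed
  then have "ennreal x * (ennreal (1 / x) * orlicz_norm \<Phi> H) \<le> ennreal x * orlicz_norm \<Phi> F"
    by (rule mult_left_mono) simp
  then show ?thesis using xx by (simp add: mult.assoc[symmetric] mult.commute[of "ennreal x"])
qed

text \<open>A single term of the modular is at most 1, whereas Phi exceeds 1 beyond some
  \<open>T\<close>. So sequences of finite Orlicz norm are bounded, which starts all convergence
  arguments.\<close>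

lemma young_modular_bounded:
  assumes \<Phi>: "young_function \<Phi>" and b: "0 < b"
    and le: "(\<integral>\<^sup>+k. \<Phi> (ennreal (norm (f k) / b)) \<partial>count_space UNIV) \<le> 1"
  obtains D where "\<And>k. norm (f k) \<le> D"
proof -
  have "((\<lambda>t::real. \<Phi> (ennreal t)) \<longlongrightarrow> \<infinity>) at_top" using \<Phi> by (simp add: young_function_def)
  then have "eventually (\<lambda>t. 1 < \<Phi> (ennreal t)) at_top"
    by (rule order_tendstoD) simp
  then obtain T where T: "\<And>t. T \<le> t \<Longrightarrow> 1 < \<Phi> (ennreal t)"
    by (auto simp: eventually_at_top_linorder)
  have "norm (f k) \<le> T * b" for k
  proof (rule ccontr)
    assume "\<not> ?thesis"
    then have "T \<le> norm (f k) / b" using b by (simp add: field_simps)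
    then have "1 < \<Phi> (ennreal (norm (f k) / b))" by (rule T)
    also have "\<dots> \<le> (\<integral>\<^sup>+k. \<Phi> (ennreal (norm (f k) / b)) \<partial>count_space UNIV)"
      by (rule le_nn_integral_count_space)
    also note le
    finally show False by simp
  qed
  then show ?thesis by (rule that)
qed

lemma modulation_space_bounded:
  assumes \<Phi>: "young_function \<Phi>" and g0: "g0 \<in> schwartz_Z" "g0 k0 \<noteq> 0"
    and f: "f \<in> modulation_space g0 \<Phi>"
  obtains D where "\<And>k. norm (f k) \<le> D"
proof -
  have "modulation_norm g0 \<Phi> f < \<infinity>" "f \<in> dual_schwartz_Z" using f by (auto simp: modulation_space_def)
  then obtain b where b: "0 < b"
    "(\<integral>\<^sup>+m. \<integral>\<^sup>+w. \<Phi> (ennreal (norm (stft g0 f m w) / b)) \<partial>torus \<partial>count_space UNIV) \<le> 1"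
    unfolding modulation_norm_def orlicz_norm_def by (auto simp: Inf_less_iff)
  show ?thesis
  proof (rule young_modular_bounded[OF \<Phi>])
    show "0 < 2 * b / norm (g0 k0)" using b g0 by simp
    show "(\<integral>\<^sup>+k. \<Phi> (ennreal (norm (f k) / (2 * b / norm (g0 k0)))) \<partial>count_space UNIV) \<le> 1"
      by (rule order_trans[OF seq_modular_le_stft_modular[OF \<Phi> b(1) g0(1) \<open>f \<in> dual_schwartz_Z\<close>] b(2)])
  qed (rule that)
qed

text \<open>The constant is the product of \<open>2 * A\<close> from
  \<open>stft_modular_le_seq_modular\<close>, \<open>2 * B\<close> from \<open>young_schur\<close>
  and \<open>2 / norm (g0 k0)\<close> from \<open>seq_modular_le_stft_modular\<close>.\<close>

lemma localization_norm_bound: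
  fixes g0 g1 g2 f :: "int^'n \<Rightarrow> complex"
  assumes \<Phi>: "young_function \<Phi>" and g0: "g0 \<in> schwartz_Z" "g0 k0 \<noteq> 0"
    and A: "0 < A" "(\<integral>\<^sup>+k. ennreal (norm (g0 k)) \<partial>count_space UNIV) \<le> ennreal A"
    and B: "0 < B"
    and \<sigma>: "\<And>m. \<sigma> m \<in> borel_measurable torus"
    and rows: "\<And>k. (\<integral>\<^sup>+j. localization_kernel (\<lambda>m. \<integral>\<^sup>+w. ennreal (norm (\<sigma> m w)) \<partial>torus) g1 g2 k j \<partial>count_space UNIV) \<le> ennreal B"
    and cols: "\<And>j. (\<integral>\<^sup>+k. localization_kernel (\<lambda>m. \<integral>\<^sup>+w. ennreal (norm (\<sigma> m w)) \<partial>torus) g1 g2 k j \<partial>count_space UNIV) \<le> ennreal B"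
    and f: "f \<in> modulation_space g0 \<Phi>"
  shows "(\<integral>\<^sup>+m. \<integral>\<^sup>+w. ennreal (norm (\<sigma> m w * stft g1 f m w * modulation w (translation m g2) k)) \<partial>torus \<partial>count_space UNIV) < \<infinity>"
    and "localization \<sigma> g1 g2 f \<in> dual_schwartz_Z"
    and "modulation_norm g0 \<Phi> (localization \<sigma> g1 g2 f) \<le>
      ennreal (8 * A * B / norm (g0 k0)) * modulation_norm g0 \<Phi> f"
proof -
  define K where "K = localization_kernel (\<lambda>m. \<integral>\<^sup>+w. ennreal (norm (\<sigma> m w)) \<partial>torus) g1 g2"
  note rows' = rows[folded K_def] and cols' = cols[folded K_def]
  obtain D where D: "\<And>k. norm (f k) \<le> D"
    using modulation_space_bounded[OF \<Phi> g0 f] by blast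
  have "0 \<le> D" using D[of 0] norm_ge_zero order_trans by blast
  have le: "(\<integral>\<^sup>+m. \<integral>\<^sup>+w. ennreal (norm (\<sigma> m w * stft g1 f m w * modulation w (translation m g2) k)) \<partial>torus \<partial>count_space UNIV)
      \<le> (\<integral>\<^sup>+j. K k j * ennreal (norm (f j)) \<partial>count_space UNIV)" for k
    unfolding K_def by (rule localization_kernel_bound[OF \<sigma>])
  have KD: "(\<integral>\<^sup>+j. K k j * ennreal (norm (f j)) \<partial>count_space UNIV) \<le> ennreal (B * D)" for k
  proof -
    have "(\<integral>\<^sup>+j. K k j * ennreal (norm (f j)) \<partial>count_space UNIV) \<le> (\<integral>\<^sup>+j. K k j * ennreal D \<partial>count_space UNIV)"
      by (intro nn_integral_mono mult_left_mono ennreal_leI D) simp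
    also have "\<dots> \<le> ennreal B * ennreal D"
      using rows'[of k] by (simp add: nn_integral_multc mult_right_mono)
    also have "\<dots> = ennreal (B * D)" using B \<open>0 \<le> D\<close> by (simp add: ennreal_mult)
    finally show ?thesis .
  qed
  show "(\<integral>\<^sup>+m. \<integral>\<^sup>+w. ennreal (norm (\<sigma> m w * stft g1 f m w * modulation w (translation m g2) k)) \<partial>torus \<partial>count_space UNIV) < \<infinity>"
    using order_trans[OF le KD, of k] by (simp add: order_le_less_trans)
  have L: "ennreal (norm (localization \<sigma> g1 g2 f k)) \<le> (\<integral>\<^sup>+j. K k j * ennreal (norm (f j)) \<partial>count_space UNIV)" for k
    by (rule order_trans[OF norm_localization_le le])
  have LD: "norm (localization \<sigma> g1 g2 f k) \<le> B * D" for k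
    using order_trans[OF L KD, of k] B \<open>0 \<le> D\<close> by (simp add: ennreal_le_iff)
  then show "localization \<sigma> g1 g2 f \<in> dual_schwartz_Z" by (rule bounded_in_dual_schwartz_Z)
  let ?\<gamma> = "norm (g0 k0)"
  have fd: "f \<in> dual_schwartz_Z" using f by (simp add: modulation_space_def)
  show "modulation_norm g0 \<Phi> (localization \<sigma> g1 g2 f) \<le> ennreal (8 * A * B / ?\<gamma>) * modulation_norm g0 \<Phi> f"
    unfolding modulation_norm_def
  proof (rule orlicz_norm_le_mult)
    show "0 < 8 * A * B / ?\<gamma>" using A B g0 by simp
    fix b :: real
    assume b: "0 < b" and le1: "(\<integral>\<^sup>+m. \<integral>\<^sup>+w. \<Phi> (ennreal (norm (stft g0 f m w) / b)) \<partial>torus \<partial>count_space UNIV) \<le> 1"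
    have b': "0 < 2 * b / ?\<gamma>" using b g0 by simp
    have "8 * A * B / ?\<gamma> * b = 2 * A * (2 * B * (2 * b / ?\<gamma>))" by simp
    then have "(\<integral>\<^sup>+m. \<integral>\<^sup>+w. \<Phi> (ennreal (norm (stft g0 (localization \<sigma> g1 g2 f) m w) / (8 * A * B / ?\<gamma> * b))) \<partial>torus \<partial>count_space UNIV)
        = (\<integral>\<^sup>+m. \<integral>\<^sup>+w. \<Phi> (ennreal (norm (stft g0 (localization \<sigma> g1 g2 f) m w) / (2 * A * (2 * B * (2 * b / ?\<gamma>))))) \<partial>torus \<partial>count_space UNIV)"
      by (simp only:)
    also have "\<dots> \<le> (\<integral>\<^sup>+k. \<Phi> (ennreal (norm (localization \<sigma> g1 g2 f k) / (2 * B * (2 * b / ?\<gamma>)))) \<partial>count_space UNIV)"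
      by (rule stft_modular_le_seq_modular[OF \<Phi> _ A LD]) (use B b' in \<open>simp only: mult_pos_pos zero_less_numeral\<close>)
    also have "\<dots> \<le> (\<integral>\<^sup>+k. \<Phi> (ennreal (norm (f k) / (2 * b / ?\<gamma>))) \<partial>count_space UNIV)"
      by (rule young_schur[OF \<Phi> B b' rows' cols' _ _ L]) simp_all
    also have "\<dots> \<le> 1"
      by (rule order_trans[OF seq_modular_le_stft_modular[OF \<Phi> b g0(1) fd] le1])
    finally show "(\<integral>\<^sup>+m. \<integral>\<^sup>+w. \<Phi> (ennreal (norm (stft g0 (localization \<sigma> g1 g2 f) m w) / (8 * A * B / ?\<gamma> * b))) \<partial>torus \<partial>count_space UNIV) \<le> 1" .
  qed
qed

lemma bounded_integrable_window:
  fixes f g :: "int^'n \<Rightarrow> complex"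
  assumes g: "(\<integral>\<^sup>+k. ennreal (norm (g k)) \<partial>count_space UNIV) < \<infinity>" and D: "\<And>k. norm (f k) \<le> D"
  shows "integrable (count_space UNIV) (\<lambda>k. f k * cnj (g (k - m)))"
proof (rule Bochner_Integration.integrable_bound)
  have "integrable (count_space UNIV) (\<lambda>k. g (k - m))"
    using g nn_integral_count_space_diff(1)[of "\<lambda>k. ennreal (norm (g k))" m]
    by (simp add: integrable_iff_bounded)
  then show "integrable (count_space UNIV) (\<lambda>k. of_real D * g (k - m))" by (rule integrable_mult_right)
  show "AE k in count_space UNIV. norm (f k * cnj (g (k - m))) \<le> norm (of_real D * g (k - m))"
    using D by (intro AE_I2) (auto simp: norm_mult intro!: mult_right_mono order_trans[OF D abs_ge_self])
qed simp

text \<open>The factor |g0(k0)| turns the l^1 norm of \<open>g1\<close> into its M^1 norm, and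
  \<open>Q\<close> turns the L^1 norm of the symbol into \<open>N\<close>. Keeping both on the left
  avoids division in \<open>ennreal\<close>.\<close>

lemma localization_kernel_le:
  fixes g0 g1 g2 :: "int^'n \<Rightarrow> complex"
  assumes g0: "g0 \<in> schwartz_Z" and g1: "g1 \<in> dual_schwartz_Z"
    and s: "ennreal Q * (\<integral>\<^sup>+m. s m \<partial>count_space UNIV) \<le> N"
  shows "ennreal (norm (g0 k0)) * ennreal Q * (\<integral>\<^sup>+j. localization_kernel s g1 g2 k j \<partial>count_space UNIV) \<le>
    M1_norm g0 g1 * linf_norm g2 * N"
proof -
  let ?P = "\<integral>\<^sup>+j. ennreal (norm (g1 j)) \<partial>count_space UNIV"
  let ?S = "\<integral>\<^sup>+m. s m \<partial>count_space UNIV"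
  have "ennreal (norm (g0 k0)) * ennreal Q * (\<integral>\<^sup>+j. localization_kernel s g1 g2 k j \<partial>count_space UNIV)
      \<le> ennreal (norm (g0 k0)) * ennreal Q * (?S * linf_norm g2 * ?P)"
    by (intro mult_left_mono localization_kernel_rows) simp
  also have "\<dots> = (ennreal (norm (g0 k0)) * ?P) * linf_norm g2 * (ennreal Q * ?S)"
    by (simp only: mult_ac)
  also have "\<dots> \<le> M1_norm g0 g1 * linf_norm g2 * N"
    by (intro mult_mono l1_le_M1_norm g0 g1 s) simp_all
  finally show ?thesis .
qed

text \<open>The square in the constant has two sources: one factor |g0(k0)| from recovering
  \<open>f\<close> from its transform, one from recovering the windows from theirs. Once both are
  absorbed into \<open>N\<close>, the operator bound has constant 1.\<close>

lemma localization_bounded_operator: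
  fixes g0 g1 g2 :: "int^'n \<Rightarrow> complex"
  assumes \<Phi>: "young_function \<Phi>" and g0: "g0 \<in> schwartz_Z" "g0 k0 \<noteq> 0"
    and A: "0 < A" "(\<integral>\<^sup>+k. ennreal (norm (g0 k)) \<partial>count_space UNIV) \<le> ennreal A"
    and \<sigma>: "\<And>m. \<sigma> m \<in> borel_measurable torus"
    and N: "ennreal (8 * A / (norm (g0 k0))\<^sup>2) *
      (\<integral>\<^sup>+m. \<integral>\<^sup>+w. ennreal (norm (\<sigma> m w)) \<partial>torus \<partial>count_space UNIV) \<le> N" "N < \<infinity>"
    and g1: "g1 \<in> M1_space g0 \<inter> linf_space" and g2: "g2 \<in> M1_space g0 \<inter> linf_space"
  shows "bounded_operator g0 \<Phi> (localization \<sigma> g1 g2)"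
    and "f \<in> modulation_space g0 \<Phi> \<Longrightarrow> localization_converges \<sigma> g1 g2 f"
    and "operator_norm g0 \<Phi> (localization \<sigma> g1 g2)
      \<le> max (M1_norm g0 g1 * linf_norm g2) (linf_norm g1 * M1_norm g0 g2) * N"
proof -
  let ?\<gamma> = "norm (g0 k0)"
  let ?K = "localization_kernel (\<lambda>m. \<integral>\<^sup>+w. ennreal (norm (\<sigma> m w)) \<partial>torus) g1 g2"
  let ?T = "localization \<sigma> g1 g2"
  define X where "X = max (M1_norm g0 g1 * linf_norm g2) (linf_norm g1 * M1_norm g0 g2) * N"
  have X_fin: "X < \<infinity>"
    using g1 g2 N(2) by (auto simp: X_def M1_space_def linf_space_def ennreal_mult_less_top max_def)
  have d: "g1 \<in> dual_schwartz_Z" "g2 \<in> dual_schwartz_Z" using g1 g2 by (auto simp: M1_space_def)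
  have K: "ennreal ?\<gamma> * ennreal (8 * A / ?\<gamma>\<^sup>2) * (\<integral>\<^sup>+j. ?K k j \<partial>count_space UNIV) \<le> X"
    "ennreal ?\<gamma> * ennreal (8 * A / ?\<gamma>\<^sup>2) * (\<integral>\<^sup>+k. ?K k j \<partial>count_space UNIV) \<le> X" for k j
  proof -
    show "ennreal ?\<gamma> * ennreal (8 * A / ?\<gamma>\<^sup>2) * (\<integral>\<^sup>+j. ?K k j \<partial>count_space UNIV) \<le> X"
      by (rule order_trans[OF localization_kernel_le[OF g0(1) d(1) N(1)]])
        (auto simp: X_def intro!: mult_right_mono)
    show "ennreal ?\<gamma> * ennreal (8 * A / ?\<gamma>\<^sup>2) * (\<integral>\<^sup>+k. ?K k j \<partial>count_space UNIV) \<le> X"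
      unfolding localization_kernel_commute[of _ g1 g2]
      by (rule order_trans[OF localization_kernel_le[OF g0(1) d(2) N(1)]])
        (auto simp: X_def mult.commute[of "M1_norm g0 g2"] intro!: mult_right_mono)
  qed
  have bounds: "(\<integral>\<^sup>+m. \<integral>\<^sup>+w. ennreal (norm (\<sigma> m w * stft g1 f m w * modulation w (translation m g2) k)) \<partial>torus \<partial>count_space UNIV) < \<infinity>"
    "?T f \<in> dual_schwartz_Z" "modulation_norm g0 \<Phi> (?T f) \<le> ennreal x * modulation_norm g0 \<Phi> f"
    if f: "f \<in> modulation_space g0 \<Phi>" and x: "X \<le> ennreal x" "0 < x" for f x k
  proof -
    \<comment> \<open>The solution of \<open>8 * A * B / norm (g0 k0) = x\<close>, the constant in
      \<open>localization_norm_bound\<close>.\<close>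
    define B where "B = x * ?\<gamma> / (8 * A)"
    have B: "0 < B" using x g0 A by (simp add: B_def)
    have leB: "R \<le> ennreal B" if "ennreal ?\<gamma> * ennreal (8 * A / ?\<gamma>\<^sup>2) * R \<le> X" for R
    proof -
      have "ennreal (?\<gamma> / (8 * A)) * (ennreal ?\<gamma> * ennreal (8 * A / ?\<gamma>\<^sup>2)) = 1"
        using g0 A by (simp add: ennreal_mult'[symmetric] power2_eq_square)
      then have "R = ennreal (?\<gamma> / (8 * A)) * (ennreal ?\<gamma> * ennreal (8 * A / ?\<gamma>\<^sup>2) * R)"
        by (simp add: mult.assoc[symmetric])
      also have "\<dots> \<le> ennreal (?\<gamma> / (8 * A)) * ennreal x"
        using that x(1) by (intro mult_left_mono) auto
      also have "\<dots> = ennreal B"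
        using x A by (simp add: ennreal_mult'[symmetric] B_def mult.commute)
      finally show ?thesis .
    qed
    note * = localization_norm_bound[OF \<Phi> g0 A B \<sigma> leB[OF K(1)] leB[OF K(2)] f]
    show "(\<integral>\<^sup>+m. \<integral>\<^sup>+w. ennreal (norm (\<sigma> m w * stft g1 f m w * modulation w (translation m g2) k)) \<partial>torus \<partial>count_space UNIV) < \<infinity>"
      by (rule *(1))
    show "?T f \<in> dual_schwartz_Z" by (rule *(2))
    have "8 * A * B / ?\<gamma> = x" using g0 A by (simp add: B_def)
    then show "modulation_norm g0 \<Phi> (?T f) \<le> ennreal x * modulation_norm g0 \<Phi> f"
      using *(3) by simp
  qed
  \<comment> \<open>\<open>X\<close> may be 0, but Schur's test asks for a positive bound. So a
    positive \<open>x\<close> above \<open>X\<close> is used, and the sharp estimate follows by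
    letting \<open>x\<close> decrease to \<open>X\<close>.\<close>
  obtain x0 where x0: "X \<le> ennreal x0" "0 < x0"
  proof (cases X)
    case (real r)
    then show ?thesis by (intro that[of "r + 1"]) (auto intro: ennreal_leI)
  qed (use X_fin in simp)
  note fin = bounds(1)[OF _ x0]
  have g1_l1: "(\<integral>\<^sup>+k. ennreal (norm (g1 k)) \<partial>count_space UNIV) < \<infinity>"
  proof -
    have "ennreal ?\<gamma> * (\<integral>\<^sup>+k. ennreal (norm (g1 k)) \<partial>count_space UNIV) < \<infinity>"
      using l1_le_M1_norm[OF g0(1) d(1), of k0] g1 by (auto simp: M1_space_def)
    then show ?thesis using g0 by (auto simp: ennreal_mult_less_top)
  qed
  have window: "integrable (count_space UNIV) (\<lambda>k. f k * cnj (g1 (k - m)))"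
    if f: "f \<in> modulation_space g0 \<Phi>" for f m
  proof -
    obtain D where "\<And>k. norm (f k) \<le> D" using modulation_space_bounded[OF \<Phi> g0 f] by blast
    then show ?thesis by (rule bounded_integrable_window[OF g1_l1])
  qed
  show "localization_converges \<sigma> g1 g2 f" if f: "f \<in> modulation_space g0 \<Phi>" for f
    unfolding localization_converges_def
  proof (intro conjI allI)
    fix m and w :: "real^'n"
    have "integrable (count_space UNIV) (\<lambda>k. f k * cnj (g1 (k - m)) * cnj (character k w))"
      by (rule Bochner_Integration.integrable_bound[OF window[OF f]]) (auto simp: norm_mult)
    then show "(\<lambda>k. f k * cnj (modulation w (translation m g1) k)) summable_on UNIV"
      by (simp only: stft_summand summable_on_iff_integrable_count_space)
  next
    fix k
    show "integrable ztorus (\<lambda>(m, w). \<sigma> m w * stft g1 f m w * modulation w (translation m g2) k)"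
      by (rule localization_summand_integrable(1)[OF \<sigma> fin[OF f]])
  qed
  have op: "operator_norm g0 \<Phi> ?T \<le> ennreal x" if x: "X \<le> ennreal x" "0 < x" for x
    unfolding operator_norm_def
  proof (rule SUP_least, clarify)
    fix f assume f: "f \<in> modulation_space g0 \<Phi>" "modulation_norm g0 \<Phi> f \<le> 1"
    have "modulation_norm g0 \<Phi> (?T f) \<le> ennreal x * modulation_norm g0 \<Phi> f"
      by (rule bounds(3)[OF f(1) x])
    also have "\<dots> \<le> ennreal x * 1" using f(2) by (intro mult_left_mono) auto
    finally show "modulation_norm g0 \<Phi> (?T f) \<le> ennreal x" by simp
  qed
  show "operator_norm g0 \<Phi> ?T \<le> max (M1_norm g0 g1 * linf_norm g2) (linf_norm g1 * M1_norm g0 g2) * N"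
    unfolding X_def[symmetric]
  proof (rule ennreal_le_epsilon)
    fix e :: real assume "0 < e"
    show "operator_norm g0 \<Phi> ?T \<le> X + ennreal e"
    proof (cases X)
      case (real r)
      then show ?thesis using op[of "r + e"] \<open>0 < e\<close> by (simp add: ennreal_plus ennreal_leI)
    qed (use X_fin in simp)
  qed
  show "bounded_operator g0 \<Phi> ?T"
    unfolding bounded_operator_def
  proof (intro conjI ballI allI)
    fix f assume f: "f \<in> modulation_space g0 \<Phi>"
    have "modulation_norm g0 \<Phi> (?T f) \<le> ennreal x0 * modulation_norm g0 \<Phi> f"
      by (rule bounds(3)[OF f x0])
    also have "\<dots> < \<infinity>" using f by (simp add: modulation_space_def ennreal_mult_less_top)
    finally show "?T f \<in> modulation_space g0 \<Phi>"
      using bounds(2)[OF f x0] by (simp add: modulation_space_def)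
    show "?T (\<lambda>k. c * f k) = (\<lambda>k. c * ?T f k)" for c by (rule localization_cmult)
    fix h assume h: "h \<in> modulation_space g0 \<Phi>"
    show "?T (\<lambda>k. f k + h k) = (\<lambda>k. ?T f k + ?T h k)"
    proof
      fix k
      have "?T (\<lambda>k. f k + h k) k = (\<Sum>\<^sub>\<infinity>m. LINT w|torus.
          \<sigma> m w * stft g1 f m w * modulation w (translation m g2) k +
          \<sigma> m w * stft g1 h m w * modulation w (translation m g2) k)"
        unfolding localization_def
        by (simp add: stft_add[OF window[OF f] window[OF h]] distrib_left distrib_right)
      also have "\<dots> = ?T f k + ?T h k"
        unfolding localization_def
        by (simp add: localization_summand_integrable[OF \<sigma> fin[OF f]]
            localization_summand_integrable[OF \<sigma> fin[OF h]] infsum_add)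
      finally show "?T (\<lambda>k. f k + h k) k = ?T f k + ?T h k" .
    qed
  next
    have "operator_norm g0 \<Phi> ?T \<le> ennreal x0" by (rule op[OF x0])
    then show "operator_norm g0 \<Phi> ?T < \<infinity>" by (simp add: order_le_less_trans)
  qed
qed

text \<open>\<open>c\<close> is quantified before Phi, \<open>\<sigma>\<close>, \<open>g1\<close>
  and \<open>g2\<close>, so one scaled window serves them all. The threshold is
  \<open>exp (- 3 / 2)\<close> since \<open>no_young_function_up_to_exp_minus_two_thirds\<close>
  rules out the larger one.\<close>

theorem proposition4p11:
  fixes g0 :: "int^'n \<Rightarrow> complex" and G0 :: "int^'n \<Rightarrow> real^'n \<Rightarrow> complex"
  assumes "g0 \<in> schwartz_Z" and "g0 \<noteq> (\<lambda>_. 0)"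
    and "G0 \<in> schwartz_ZT" and "G0 \<noteq> (\<lambda>_ _. 0)"
  shows "\<exists>c>0. let G = (\<lambda>m w. complex_of_real c * G0 m w) in
    \<forall>\<Phi> \<sigma> g1 g2.
      young_function \<Phi> \<longrightarrow>
      (\<forall>x::real. 0 \<le> x \<and> x \<le> exp (- 3 / 2) \<longrightarrow> \<Phi> (ennreal x) = ennreal (- (x\<^sup>2 * ln x))) \<longrightarrow>
      \<sigma> \<in> M1_space_ZT G \<longrightarrow>
      g1 \<in> M1_space g0 \<inter> linf_space \<longrightarrow>
      g2 \<in> M1_space g0 \<inter> linf_space \<longrightarrow>
      (\<exists>L. bounded_operator g0 \<Phi> L \<and>
           (\<forall>f\<in>modulation_space g0 \<Phi>.
              localization_converges \<sigma> g1 g2 f \<and> L f = localization \<sigma> g1 g2 f) \<and>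
           operator_norm g0 \<Phi> L
             \<le> max (M1_norm g0 g1 * linf_norm g2) (linf_norm g1 * M1_norm g0 g2)
                * M1_norm_ZT G \<sigma>)"
proof -
  obtain k0 where k0: "g0 k0 \<noteq> 0" using assms(2) by auto
  obtain k1 y1 where y1: "G0 k1 y1 \<noteq> 0" using assms(4) by (auto simp: fun_eq_iff)
  obtain a where a: "a \<in> schwartz_Z" "\<And>k y. norm (G0 k y) \<le> norm (a k)"
    using schwartz_ZT_envelope[OF assms(3)] by blast
  have cont: "continuous_on UNIV (G0 k)" for k by (rule schwartz_ZT_continuous[OF assms(3)])
  have per: "periodic (G0 k)" for k using assms(3) by (simp add: schwartz_ZT_def)
  \<comment> \<open>The summand 1 makes positivity of \<open>A\<close> immediate.\<close>
  define A where "A = enn2real (\<integral>\<^sup>+k. ennreal (norm (g0 k)) \<partial>count_space UNIV) + 1"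
  have A: "0 < A" "(\<integral>\<^sup>+k. ennreal (norm (g0 k)) \<partial>count_space UNIV) \<le> ennreal A"
  proof -
    have "ennreal (enn2real (\<integral>\<^sup>+k. ennreal (norm (g0 k)) \<partial>count_space UNIV)) \<le> ennreal A"
      unfolding A_def by (intro ennreal_leI) simp
    then show "(\<integral>\<^sup>+k. ennreal (norm (g0 k)) \<partial>count_space UNIV) \<le> ennreal A"
      using schwartz_Z_nn_integral_finite[OF assms(1)] by simp
  qed (simp add: A_def add_nonneg_pos)
  define q where "q = (\<integral>\<^sup>+y. ennreal (norm (G0 k1 y)) \<partial>torus)"
  have "q \<le> (\<integral>\<^sup>+y. ennreal (norm (a k1)) \<partial>(torus :: (real^'n) measure))"
    unfolding q_def by (intro nn_integral_mono ennreal_leI a)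
  then have "q < \<infinity>" by (simp add: order_le_less_trans)
  moreover have "0 < q" unfolding q_def by (rule nn_integral_torus_pos[where ?y0.0 = y1]) (rule cont per y1)+
  ultimately obtain r where r: "q = ennreal r" "0 < r"
    by (cases q) auto
  \<comment> \<open>\<open>r\<close> is the L^1 norm of \<open>G0 k1\<close>, so scaling by
    \<open>c\<close> gives the slice \<open>k1\<close> exactly the norm that
    \<open>localization_bounded_operator\<close> puts in front of the L^1 norm of
    \<open>\<sigma>\<close>.\<close>
  define c where "c = 8 * A / (norm (g0 k0))\<^sup>2 / r"
  have c: "0 < c" using A k0 r by (simp add: c_def)
  let ?G = "\<lambda>m w. complex_of_real c * G0 m w"
  have N: "ennreal (8 * A / (norm (g0 k0))\<^sup>2) *
      (\<integral>\<^sup>+m. \<integral>\<^sup>+w. ennreal (norm (\<sigma> m w)) \<partial>torus \<partial>count_space UNIV) \<le> M1_norm_ZT ?G \<sigma>"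
    if "\<sigma> \<in> dual_schwartz_ZT" for \<sigma>
  proof -
    have "(\<integral>\<^sup>+y. ennreal (norm (?G k1 y)) \<partial>torus) = ennreal c * q"
      using c continuous_imp_measurable_torus[OF cont[of k1]]
      by (simp add: norm_mult ennreal_mult nn_integral_cmult q_def)
    also have "\<dots> = ennreal (8 * A / (norm (g0 k0))\<^sup>2)"
      using r c by (simp add: ennreal_mult'[symmetric] c_def)
    finally have q: "(\<integral>\<^sup>+y. ennreal (norm (?G k1 y)) \<partial>torus) = ennreal (8 * A / (norm (g0 k0))\<^sup>2)" .
    show ?thesis
      unfolding q[symmetric]
    proof (rule L1_le_M1_norm_ZT[OF that])
      show "periodic (?G k)" for k using per[of k] by (simp add: periodic_def)
      show "continuous_on UNIV (?G k)" for k by (intro continuous_intros cont)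
      show "(\<lambda>k. complex_of_real c * a k) \<in> schwartz_Z"
        unfolding schwartz_Z_def
      proof (intro CollectI allI)
        fix M :: nat
        obtain C where "\<And>k. norm (a k) \<le> C / (1 + norm (rvec k)) ^ M"
          using a(1) unfolding schwartz_Z_def by blast
        then have "c * norm (a k) \<le> c * (C / (1 + norm (rvec k)) ^ M)" for k
          using c by (intro mult_left_mono) auto
        then show "\<exists>C. \<forall>k. norm (complex_of_real c * a k) \<le> C / (1 + norm (rvec k)) ^ M"
          using c by (intro exI[of _ "c * C"]) (simp add: norm_mult)
      qed
      show "norm (?G k y) \<le> norm (complex_of_real c * a k)" for k y
        using a(2)[of k y] by (simp add: norm_mult mult_left_mono)
    qed
  qed
  show ?thesis
  proof (intro exI[of _ c] conjI c, unfold Let_def, intro allI impI)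
    fix \<Phi> \<sigma> g1 g2
    assume \<Phi>: "young_function \<Phi>" and \<sigma>: "\<sigma> \<in> M1_space_ZT ?G"
      and g: "g1 \<in> M1_space g0 \<inter> linf_space" "g2 \<in> M1_space g0 \<inter> linf_space"
    have \<sigma>_dual: "\<sigma> \<in> dual_schwartz_ZT" and fin: "M1_norm_ZT ?G \<sigma> < \<infinity>"
      using \<sigma> by (auto simp: M1_space_ZT_def)
    have \<sigma>_meas: "\<sigma> m \<in> borel_measurable torus" for m
      using dual_schwartz_ZT_integrable(1)[OF \<sigma>_dual, of m] by simp
    note bounded = localization_bounded_operator[OF \<Phi> assms(1) k0 A \<sigma>_meas N[OF \<sigma>_dual] fin g]
    show "\<exists>L. bounded_operator g0 \<Phi> L \<and>
           (\<forall>f\<in>modulation_space g0 \<Phi>.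
              localization_converges \<sigma> g1 g2 f \<and> L f = localization \<sigma> g1 g2 f) \<and>
           operator_norm g0 \<Phi> L
             \<le> max (M1_norm g0 g1 * linf_norm g2) (linf_norm g1 * M1_norm g0 g2)
                * M1_norm_ZT ?G \<sigma>"
      using bounded by (intro exI[of _ "localization \<sigma> g1 g2"]) blast
  qed
qed

end
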